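(* Let $\mathcal{P}$ be a finite reduced polyhedral poset and let $(\mathbf{X},\mathbf{A})=\{(X_v,A_v)\mid v\in V_\mathcal{P}\}$ be a collection of NDR-pairs such that $X_v\ne A_v$ for all $v$. Then the natural map $$\mathcal{Z}_\mathcal{P}(\mathbf{X},\mathbf{A})\to\mathcal{Z}_{s(\mathcal{P})}(\mathbf{X},\mathbf{A})$$ induced by the poset map $s\colon\mathcal{P}\to s(\mathcal{P})$, $x\mapsto[x,V(x)]$, is a homotopy equivalence.
   Context: A poset $\mathcal{P}$ is regarded as a small category with exactly one morphism $\iota_{x,y}\colon x\to y$ whenever $x\le y$. It is pointed if it has an initial (least) object $*$. A vertex is an object $v\ne *$ such that $y<v$ implies $y=*$. $V_\mathcal{P}$ is the set of vertices, and $V(x)=\{v\in V_\mathcal{P}\mid v\le x\}$. $[x\vee y]$ is the set of minimal upper bounds of $\{x,y\}$. A finite pointed poset $\mathcal{P}$ is polyhedral if for each $x$ the sub-poset $\mathcal{P}_{\le x}=\{y\mid y\le x\}$ is a lower semilattice (any two objects have a meet). It is reduced if $x\le y$ and $V(x)=V(y)$ imply $x=y$. Polyhedral product: $\mathcal{Z}^\mathcal{P}_{\mathbf{X},\mathbf{A}}\colon\mathcal{P}\to\mathbf{Top}$ is the functor with $\mathcal{Z}^\mathcal{P}_{\mathbf{X},\mathbf{A}}(x)=\prod_{v\in V_\mathcal{P}}Y_v$, where $Y_v=X_v$ if $v\in V(x)$ and $Y_v=A_v$ otherwise, sending $\iota_{x,y}$ to the obvious inclusion. Then $\mathcal{Z}_\mathcal{P}(\mathbf{X},\mathbf{A})=\operatorname{hocolim}_{\mathcal{P}}\mathcal{Z}^\mathcal{P}_{\mathbf{X},\mathbf{A}}$.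 Simplicial transform: on the set of pairs $(x,S)$ with $x\in\mathcal{P}$ and $S\subseteq V(x)$, take the equivalence relation that is the transitive closure of the relation $(x,S)\sim(y,T)$ if $S=T$ and $[x\vee y]\ne\emptyset$. $s(\mathcal{P})$ is the set of equivalence classes $[x,S]$, partially ordered by $[x,S]\le[y,T]$ if, for some choice of representatives $(x,S)$ and $(y,T)$, $S\subseteq T$ and $[x\vee y]\ne\emptyset$. The vertices of $s(\mathcal{P})$ are the classes $[v,\{v\}]$, identified with $v\in V_\mathcal{P}$, so $V_{s(\mathcal{P})}=V_\mathcal{P}$ and $V([x,S])=S$. Consequently $\mathcal{Z}^{\mathcal{P}}_{\mathbf{X},\mathbf{A}}=\mathcal{Z}^{s(\mathcal{P})}_{\mathbf{X},\mathbf{A}}\circ s$, and the natural map is the induced map of homotopy colimits. *)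

theory Defs
  imports "HOL-Analysis.Analysis" "HOL-Algebra.Lattice"
begin

text \<open>Posets are records of type \<open>'p gorder\<close> satisfying the locale predicate
  \<^const>\<open>partial_order\<close>; then \<open>\<bottom>\<close> is the initial object.\<close>

section \<open>Polyhedral posets\<close>

definition below :: "'p gorder \<Rightarrow> 'p \<Rightarrow> 'p gorder" where
  "below P x = P\<lparr>carrier := {y \<in> carrier P. y \<sqsubseteq>\<^bsub>P\<^esub> x}\<rparr>"

definition pointed :: "'p gorder \<Rightarrow> bool" where
  "pointed P \<longleftrightarrow> (\<exists>b. least P b (carrier P))"

definition polyhedral :: "'p gorder \<Rightarrow> bool" where
  "polyhedral P \<longleftrightarrow> partial_order P \<and> finite (carrier P) \<and> pointed P \<and>
     (\<forall>x\<in>carrier P. lower_semilattice (below P x))"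

definition vertices :: "'p gorder \<Rightarrow> 'p set" where
  "vertices P = {v \<in> carrier P. v \<noteq> \<bottom>\<^bsub>P\<^esub> \<and> (\<forall>y\<in>carrier P. y \<sqsubset>\<^bsub>P\<^esub> v \<longrightarrow> y = \<bottom>\<^bsub>P\<^esub>)}"

definition vertices_of :: "'p gorder \<Rightarrow> 'p \<Rightarrow> 'p set" where
  "vertices_of P x = {v \<in> vertices P. v \<sqsubseteq>\<^bsub>P\<^esub> x}"

definition reduced_poset :: "'p gorder \<Rightarrow> bool" where
  "reduced_poset P \<longleftrightarrow> (\<forall>x\<in>carrier P. \<forall>y\<in>carrier P.
     x \<sqsubseteq>\<^bsub>P\<^esub> y \<and> vertices_of P x = vertices_of P y \<longrightarrow> x = y)"

definition minimal_upper_bounds :: "'p gorder \<Rightarrow> 'p \<Rightarrow> 'p \<Rightarrow> 'p set" where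
  "minimal_upper_bounds P x y =
     {z \<in> Upper P {x, y}. \<forall>w\<in>Upper P {x, y}. w \<sqsubseteq>\<^bsub>P\<^esub> z \<longrightarrow> w = z}"


section \<open>The simplicial transform\<close>

definition st_pairs :: "'p gorder \<Rightarrow> ('p \<times> 'p set) set" where
  "st_pairs P = {(x, S). x \<in> carrier P \<and> S \<subseteq> vertices_of P x}"

definition st_rel :: "'p gorder \<Rightarrow> ('p \<times> 'p set) rel" where
  "st_rel P = {((x, S), (y, T)). (x, S) \<in> st_pairs P \<and> (y, T) \<in> st_pairs P \<and>
                                 S = T \<and> minimal_upper_bounds P x y \<noteq> {}}\<^sup>+"

definition st_class :: "'p gorder \<Rightarrow> 'p \<Rightarrow> 'p set \<Rightarrow> ('p \<times> 'p set) set" where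
  "st_class P x S = st_rel P `` {(x, S)}"

definition simplicial_transform :: "'p gorder \<Rightarrow> ('p \<times> 'p set) set gorder" where
  "simplicial_transform P =
     \<lparr>carrier = st_pairs P // st_rel P,
      eq = (=),
      le = (\<lambda>c d. \<exists>(x, S)\<in>c. \<exists>(y, T)\<in>d. S \<subseteq> T \<and> minimal_upper_bounds P x y \<noteq> {})\<rparr>"

definition st_map :: "'p gorder \<Rightarrow> 'p \<Rightarrow> ('p \<times> 'p set) set" where
  "st_map P x = st_class P x (vertices_of P x)"

text \<open>The identification of the vertices of \<open>P\<close> with those of its simplicial transform,
  and its inverse.\<close>

definition st_vertex :: "'p gorder \<Rightarrow> 'p \<Rightarrow> ('p \<times> 'p set) set" where
  "st_vertex P v = st_class P v {v}"

definition st_label :: "'p gorder \<Rightarrow> ('p \<times> 'p set) set \<Rightarrow> 'p" where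
  "st_label P = inv_into (vertices P) (st_vertex P)"


section \<open>Spaces\<close>

definition NDR_pair :: "'a topology \<Rightarrow> 'a set \<Rightarrow> bool" where
  "NDR_pair X A \<longleftrightarrow> A \<subseteq> topspace X \<and>
     (\<exists>u h. continuous_map X (top_of_set {0..1::real}) u \<and>
            continuous_map (prod_topology X (top_of_set {0..1::real})) X h \<and>
            A = {x \<in> topspace X. u x = 0} \<and>
            (\<forall>x\<in>topspace X. h (x, 0) = x) \<and>
            (\<forall>a\<in>A. \<forall>t\<in>{0..1}. h (a, t) = a) \<and>
            (\<forall>x\<in>topspace X. u x < 1 \<longrightarrow> h (x, 1) \<in> A))"

definition homotopy_equivalence :: "'a topology \<Rightarrow> 'b topology \<Rightarrow> ('a \<Rightarrow> 'b) \<Rightarrow> bool" where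
  "homotopy_equivalence X Y f \<longleftrightarrow> continuous_map X Y f \<and>
     (\<exists>g. continuous_map Y X g \<and>
          homotopic_with (\<lambda>_. True) X X (g \<circ> f) id \<and>
          homotopic_with (\<lambda>_. True) Y Y (f \<circ> g) id)"

definition quotient_space :: "'a topology \<Rightarrow> 'a rel \<Rightarrow> 'a set topology" where
  "quotient_space X E =
     topology (\<lambda>U. U \<subseteq> topspace X // E \<and> openin X {x \<in> topspace X. E `` {x} \<in> U})"

lemma istopology_quotient_space:
  "istopology (\<lambda>U. U \<subseteq> topspace X // E \<and> openin X {x \<in> topspace X. E `` {x} \<in> U})"
proof -
  have 1: "{x \<in> topspace X. E `` {x} \<in> S \<inter> T} =
      {x \<in> topspace X. E `` {x} \<in> S} \<inter> {x \<in> topspace X. E `` {x} \<in> T}" for S T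
    by auto
  have 2: "{x \<in> topspace X. E `` {x} \<in> \<Union>K} =
      (\<Union>S\<in>K. {x \<in> topspace X. E `` {x} \<in> S})" for K
    by auto
  show ?thesis
    unfolding istopology_def 1 2 by blast
qed

lemma openin_quotient_space:
  "openin (quotient_space X E) U \<longleftrightarrow>
     U \<subseteq> topspace X // E \<and> openin X {x \<in> topspace X. E `` {x} \<in> U}"
  by (simp add: quotient_space_def istopology_quotient_space topology_inverse')

lemma topspace_quotient_space: "topspace (quotient_space X E) = topspace X // E"
proof -
  have "{x \<in> topspace X. E `` {x} \<in> topspace X // E} = topspace X"
    by (auto simp: quotient_def)
  then have "openin (quotient_space X E) (topspace X // E)"
    by (simp add: openin_quotient_space)
  then show ?thesis
    by (meson openin_quotient_space openin_subset openin_topspace subset_antisym)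
qed

lemma quotient_map_quotient_space:
  "quotient_map X (quotient_space X E) (\<lambda>x. E `` {x})"
  unfolding quotient_map_def topspace_quotient_space openin_quotient_space
  by (auto simp: quotient_def)


section \<open>Homotopy colimits over finite posets\<close>

text \<open>
  The geometric realization of the nerve of a finite poset, in barycentric coordinates: points
  are formal convex combinations of the objects whose support is a chain.  As the poset is
  finite, the weak topology is the one inherited from the product.
\<close>

definition nerve :: "'p gorder \<Rightarrow> ('p \<Rightarrow> real) topology" where
  "nerve P = subtopology (product_topology (\<lambda>_. euclideanreal) (carrier P))
     {t. (\<forall>x\<in>carrier P. 0 \<le> t x) \<and> (\<Sum>x\<in>carrier P. t x) = 1 \<and>
         (\<forall>x\<in>carrier P. \<forall>y\<in>carrier P. t x \<noteq> 0 \<and> t y \<noteq> 0 \<longrightarrow> x \<sqsubseteq>\<^bsub>P\<^esub> y \<or> y \<sqsubseteq>\<^bsub>P\<^esub> x)}"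

text \<open>
  The under-category of \<open>x\<close> is the sub-poset of all \<open>y\<close> with \<open>x \<sqsubseteq> y\<close>; its realized nerve is
  regarded as a subspace of that of \<open>P\<close>.
\<close>

definition under_nerve :: "'p gorder \<Rightarrow> 'p \<Rightarrow> ('p \<Rightarrow> real) topology" where
  "under_nerve P x = subtopology (nerve P) {t. \<forall>y\<in>carrier P. t y \<noteq> 0 \<longrightarrow> x \<sqsubseteq>\<^bsub>P\<^esub> y}"

text \<open>
  A functor from \<open>P\<close> to topological spaces is given by its values \<open>F x\<close> and by maps
  \<open>f x y : F x \<rightarrow> F y\<close> for \<open>x \<sqsubseteq> y\<close>.  Its homotopy colimit is the Bousfield-Kan coend of
  \<open>F x \<times> |N(x \<down> P)|\<close>, i.e. the quotient of the disjoint union of these spaces by the equivalence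
  relation generated by \<open>(x, p, t) ~ (y, f x y p, t)\<close> for \<open>x \<sqsubseteq> y\<close>, \<open>p \<in> F x\<close> and
  \<open>t \<in> |N(y \<down> P)| \<subseteq> |N(x \<down> P)|\<close>.
\<close>

definition hocolim_glue ::
    "'p gorder \<Rightarrow> ('p \<Rightarrow> 'b topology) \<Rightarrow> ('p \<Rightarrow> 'p \<Rightarrow> 'b \<Rightarrow> 'b) \<Rightarrow> ('p \<times> 'b \<times> ('p \<Rightarrow> real)) rel" where
  "hocolim_glue P F f =
     {((x, p, t), (y, f x y p, t)) | x y p t. x \<in> carrier P \<and> y \<in> carrier P \<and> x \<sqsubseteq>\<^bsub>P\<^esub> y \<and>
        p \<in> topspace (F x) \<and> t \<in> topspace (under_nerve P y)}"

definition hocolim_rel ::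
    "'p gorder \<Rightarrow> ('p \<Rightarrow> 'b topology) \<Rightarrow> ('p \<Rightarrow> 'p \<Rightarrow> 'b \<Rightarrow> 'b) \<Rightarrow> ('p \<times> 'b \<times> ('p \<Rightarrow> real)) rel" where
  "hocolim_rel P F f = (hocolim_glue P F f \<union> (hocolim_glue P F f)\<inverse>)\<^sup>*"

definition hocolim ::
    "'p gorder \<Rightarrow> ('p \<Rightarrow> 'b topology) \<Rightarrow> ('p \<Rightarrow> 'p \<Rightarrow> 'b \<Rightarrow> 'b) \<Rightarrow>
     ('p \<times> 'b \<times> ('p \<Rightarrow> real)) set topology" where
  "hocolim P F f =
     quotient_space (sum_topology (\<lambda>x. prod_topology (F x) (under_nerve P x)) (carrier P))
       (hocolim_rel P F f)"

definition nerve_map :: "'p gorder \<Rightarrow> 'q gorder \<Rightarrow> ('p \<Rightarrow> 'q) \<Rightarrow> ('p \<Rightarrow> real) \<Rightarrow> 'q \<Rightarrow> real" where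
  "nerve_map P Q \<alpha> t = (\<lambda>w\<in>carrier Q. \<Sum>x | x \<in> carrier P \<and> \<alpha> x = w. t x)"

text \<open>
  The map \<open>hocolim P F \<rightarrow> hocolim Q G\<close> induced by a poset map \<open>\<alpha> : P \<rightarrow> Q\<close> together with a natural
  transformation \<open>\<eta> x : F x \<rightarrow> G (\<alpha> x)\<close>.  The union is over representatives of one class, and all
  the sets in it are equal.
\<close>

definition hocolim_map ::
    "'p gorder \<Rightarrow> 'q gorder \<Rightarrow> ('q \<Rightarrow> 'c topology) \<Rightarrow> ('q \<Rightarrow> 'q \<Rightarrow> 'c \<Rightarrow> 'c) \<Rightarrow>
     ('p \<Rightarrow> 'q) \<Rightarrow> ('p \<Rightarrow> 'b \<Rightarrow> 'c) \<Rightarrow>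
     ('p \<times> 'b \<times> ('p \<Rightarrow> real)) set \<Rightarrow> ('q \<times> 'c \<times> ('q \<Rightarrow> real)) set" where
  "hocolim_map P Q G g \<alpha> \<eta> c =
     (\<Union>(x, p, t)\<in>c. hocolim_rel Q G g `` {(\<alpha> x, \<eta> x p, nerve_map P Q \<alpha> t)})"


section \<open>Polyhedral products\<close>

definition polyhedral_functor ::
    "'p gorder \<Rightarrow> ('p \<Rightarrow> 'a topology) \<Rightarrow> ('p \<Rightarrow> 'a set) \<Rightarrow> 'p \<Rightarrow> ('p \<Rightarrow> 'a) topology" where
  "polyhedral_functor P X A x =
     product_topology (\<lambda>v. if v \<in> vertices_of P x then X v else subtopology (X v) (A v)) (vertices P)"

text \<open>All the structure maps of the functor are inclusions, so they act as the identity on points.\<close>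

definition polyhedral_inclusion :: "'p \<Rightarrow> 'p \<Rightarrow> ('p \<Rightarrow> 'a) \<Rightarrow> 'p \<Rightarrow> 'a" where
  "polyhedral_inclusion x y = id"

definition polyhedral_product ::
    "'p gorder \<Rightarrow> ('p \<Rightarrow> 'a topology) \<Rightarrow> ('p \<Rightarrow> 'a set) \<Rightarrow>
     ('p \<times> ('p \<Rightarrow> 'a) \<times> ('p \<Rightarrow> real)) set topology" where
  "polyhedral_product P X A = hocolim P (polyhedral_functor P X A) polyhedral_inclusion"

text \<open>
  The pairs indexed by the vertices of \<open>P\<close>, reindexed by those of the simplicial transform, and the
  resulting identification of points of the products.
\<close>

definition st_family :: "'p gorder \<Rightarrow> ('p \<Rightarrow> 'c) \<Rightarrow> ('p \<times> 'p set) set \<Rightarrow> 'c" where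
  "st_family P X w = X (st_label P w)"

definition st_reindex :: "'p gorder \<Rightarrow> ('p \<Rightarrow> 'a) \<Rightarrow> ('p \<times> 'p set) set \<Rightarrow> 'a" where
  "st_reindex P p = (\<lambda>w\<in>vertices (simplicial_transform P). p (st_label P w))"

definition st_natural_map ::
    "'p gorder \<Rightarrow> ('p \<Rightarrow> 'a topology) \<Rightarrow> ('p \<Rightarrow> 'a set) \<Rightarrow>
     ('p \<times> ('p \<Rightarrow> 'a) \<times> ('p \<Rightarrow> real)) set \<Rightarrow>
     (('p \<times> 'p set) set \<times> (('p \<times> 'p set) set \<Rightarrow> 'a) \<times> (('p \<times> 'p set) set \<Rightarrow> real)) set" where
  "st_natural_map P X A =
     hocolim_map P (simplicial_transform P)
       (polyhedral_functor (simplicial_transform P) (st_family P X) (st_family P A))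
       polyhedral_inclusion (st_map P) (\<lambda>_. st_reindex P)"

end

theory Submission
  imports Defs
begin

text \<open>
  The map \<open>s : P \<rightarrow> s(P)\<close> has a left adjoint, and this makes it homotopically cofinal.

  Fix \<open>[x, S]\<close> in \<open>s(P)\<close> and consider the set of all \<open>y\<close> with \<open>(y, S)\<close> in this class. If two
  elements of this set have a common upper bound, their meet below that bound exists because
  \<open>P\<close> is polyhedral, and the meet is still above every vertex of \<open>S\<close>. Following a chain of such
  steps, any two elements of the set have a common lower bound in the set, so the set, being finite,
  has a least element \<open>b\<close> (\<open>st_class_principal\<close>). Thus an element of \<open>s(P)\<close> is the same thing as its
  base \<open>b\<close> together with its support \<open>S\<close>, and in these coordinates the order of \<open>s(P)\<close> is the
  componentwise one (\<open>simplicial_transform_le_iff\<close>). The map \<open>s\<close> sends \<open>x\<close> to the pair with support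
  \<open>V(x)\<close> and a base \<open>b \<sqsubseteq> x\<close> such that \<open>V(b) = V(x)\<close>; as \<open>P\<close> is reduced, the base is \<open>x\<close>. So the base map
  \<open>l : s(P) \<rightarrow> P\<close> is monotone with \<open>l (s x) = x\<close> and \<open>c \<sqsubseteq> s (l c)\<close>.

  Any such Galois retraction induces an equivalence of homotopy colimits
  (\<open>homotopy_equivalence_hocolim_map\<close>), for every diagram \<open>G\<close> on the target and every diagram on the
  source that is isomorphic to its pullback. The inverse is induced by \<open>l\<close> and the structure maps
  \<open>G c \<rightarrow> G (s (l c))\<close>. One composite is the identity because \<open>l \<circ> s\<close> is. The other one is induced by
  the poset map \<open>s \<circ> l\<close>, which lies above the identity, and is joined to the identity by the homotopy
  that pushes the mass of a point of the nerve from \<open>c\<close> to \<open>s (l c)\<close>, starting at the top of its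
  supporting chain (\<open>homotopic_hocolim_map_inflationary\<close>).

  What remains is to identify the polyhedral diagram on \<open>P\<close> with the pullback of the one on
  \<open>s(P)\<close>: the vertices of \<open>s(P)\<close> are the classes \<open>[v, {v}]\<close> (\<open>vertices_simplicial_transform\<close>), and
  those below \<open>s(x)\<close> come from the vertices below \<open>x\<close>, so reindexing is a homeomorphism of the products.
\<close>

section \<open>Maps out of disjoint unions\<close>

text \<open>
  A homotopy defined on a disjoint union can be checked summand by summand, since
  \<open>Z \<times> X i\<close> is open in \<open>Z \<times> (\<Sum>i. X i)\<close>.
\<close>

lemma continuous_map_prod_sum_topology:
  "continuous_map (prod_topology Z (sum_topology X I)) Y h \<longleftrightarrow>
     (\<forall>i\<in>I. continuous_map (prod_topology Z (X i)) Y (\<lambda>(z, x). h (z, (i, x))))"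
  (is "?lhs \<longleftrightarrow> ?rhs")
proof
  assume L: ?lhs
  show ?rhs
  proof
    fix i assume i: "i \<in> I"
    have "continuous_map (prod_topology Z (X i)) (prod_topology Z (sum_topology X I))
            (\<lambda>zx. (fst zx, (i, snd zx)))"
      using continuous_map_compose[OF continuous_map_snd continuous_map_component_injection[OF i],
          of Z X]
      by (intro continuous_map_pairedI continuous_map_fst) (simp add: o_def)
    from continuous_map_compose[OF this L]
    show "continuous_map (prod_topology Z (X i)) Y (\<lambda>(z, x). h (z, (i, x)))"
      by (simp add: o_def case_prod_unfold)
  qed
next
  assume R: ?rhs
  show ?lhs
  proof (rule continuous_map_openin_preimage_eq[THEN iffD2], intro conjI allI impI)
    show "h \<in> topspace (prod_topology Z (sum_topology X I)) \<rightarrow> topspace Y"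
      using R by (auto simp: continuous_map_def Pi_iff)
    fix U assume U: "openin Y U"
    let ?pre = "topspace (prod_topology Z (sum_topology X I)) \<inter> h -` U"
    have "\<exists>V W. openin Z V \<and> openin (sum_topology X I) W \<and> z \<in> V \<and> w \<in> W \<and> V \<times> W \<subseteq> ?pre"
      if zw: "(z, w) \<in> ?pre" for z w
    proof -
      obtain i x where w: "w = (i, x)" and i: "i \<in> I" and x: "x \<in> topspace (X i)"
        using zw by auto
      let ?S = "{a \<in> topspace (prod_topology Z (X i)). h (fst a, (i, snd a)) \<in> U}"
      have "openin (prod_topology Z (X i)) ?S"
        using R i U by (auto simp: continuous_map_def case_prod_unfold)
      moreover have "(z, x) \<in> ?S"
        using zw w x by simp
      ultimately obtain V W where V: "openin Z V" "openin (X i) W" "z \<in> V" "x \<in> W"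
        "V \<times> W \<subseteq> ?S"
        unfolding openin_prod_topology_alt by meson
      have "openin (sum_topology X I) (Pair i ` W)"
        using open_map_component_injection[OF i, of X] V(2) by (simp add: open_map_def)
      moreover have "V \<times> Pair i ` W \<subseteq> ?pre"
        using V(5) i by fastforce
      ultimately show ?thesis
        using V(1,3,4) w by (intro exI[of _ V] exI[of _ "Pair i ` W"]) simp
    qed
    then show "openin (prod_topology Z (sum_topology X I)) ?pre"
      unfolding openin_prod_topology_alt by blast
  qed
qed

lemma continuous_map_sum_topology:
  "continuous_map (sum_topology X I) Y h \<longleftrightarrow> (\<forall>i\<in>I. continuous_map (X i) Y (\<lambda>x. h (i, x)))"
  (is "?lhs \<longleftrightarrow> ?rhs")
proof
  assume L: ?lhs
  show ?rhs
    using continuous_map_compose[OF continuous_map_component_injection L] by (auto simp: o_def)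
next
  assume R: ?rhs
  show ?lhs
  proof (rule continuous_map_openin_preimage_eq[THEN iffD2], intro conjI allI impI)
    show "h \<in> topspace (sum_topology X I) \<rightarrow> topspace Y"
      using R by (auto simp: continuous_map_def Pi_iff)
    fix U assume U: "openin Y U"
    have "{x. (i, x) \<in> topspace (sum_topology X I) \<inter> h -` U} = {x \<in> topspace (X i). h (i, x) \<in> U}"
      if "i \<in> I" for i
      using that by auto
    then show "openin (sum_topology X I) (topspace (sum_topology X I) \<inter> h -` U)"
      using R U by (simp add: openin_sum_topology continuous_map_def le_infI1)
  qed
qed

section \<open>Nerves of finite posets\<close>

lemma topspace_nerve_iff:
  "t \<in> topspace (nerve P) \<longleftrightarrow>
     t \<in> extensional (carrier P) \<and> (\<forall>x\<in>carrier P. 0 \<le> t x) \<and> (\<Sum>x\<in>carrier P. t x) = 1 \<and>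
     (\<forall>x\<in>carrier P. \<forall>y\<in>carrier P. t x \<noteq> 0 \<and> t y \<noteq> 0 \<longrightarrow> x \<sqsubseteq>\<^bsub>P\<^esub> y \<or> y \<sqsubseteq>\<^bsub>P\<^esub> x)"
  by (auto simp: nerve_def PiE_def)

lemma topspace_under_nerve_iff:
  "t \<in> topspace (under_nerve P x) \<longleftrightarrow>
     t \<in> topspace (nerve P) \<and> (\<forall>y\<in>carrier P. t y \<noteq> 0 \<longrightarrow> x \<sqsubseteq>\<^bsub>P\<^esub> y)"
  by (auto simp: under_nerve_def)

lemma continuous_map_into_under_nerve:
  "continuous_map Z (under_nerve P x) h \<longleftrightarrow>
     h \<in> topspace Z \<rightarrow> topspace (under_nerve P x) \<and>
     (\<forall>y\<in>carrier P. continuous_map Z euclideanreal (\<lambda>z. h z y))"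
proof -
  have un: "under_nerve P x =
      subtopology (product_topology (\<lambda>_. euclideanreal) (carrier P)) (topspace (under_nerve P x))"
    unfolding under_nerve_def nerve_def subtopology_subtopology topspace_subtopology
    by (simp only: subtopology_restrict Int_assoc)
  show ?thesis
    apply (subst un)
    unfolding continuous_map_in_subtopology continuous_map_componentwise
    by (auto simp: topspace_under_nerve_iff topspace_nerve_iff)
qed

lemma continuous_map_under_nerve_coordinate:
  assumes "y \<in> carrier P"
  shows "continuous_map (under_nerve P x) euclideanreal (\<lambda>t. t y)"
  unfolding under_nerve_def nerve_def
  by (intro continuous_map_from_subtopology continuous_map_product_projection assms)

lemma nerve_map_support:
  assumes "nerve_map P Q \<alpha> t w \<noteq> 0" and "w \<in> carrier Q"
  obtains x where "x \<in> carrier P" "\<alpha> x = w" "t x \<noteq> 0"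
  using assms sum.not_neutral_contains_not_neutral[of t "{x \<in> carrier P. \<alpha> x = w}"]
  by (auto simp: nerve_map_def)

lemma sum_nerve_map:
  assumes "finite (carrier P)" "finite (carrier Q)" "\<alpha> \<in> carrier P \<rightarrow> carrier Q"
  shows "(\<Sum>w\<in>carrier Q. nerve_map P Q \<alpha> t w) = (\<Sum>x\<in>carrier P. t x)"
  using sum.group[of "carrier P" "carrier Q" \<alpha> t] assms
  by (simp add: nerve_map_def image_subset_iff_funcset)

lemma nerve_map_in_under_nerve:
  assumes fin: "finite (carrier P)" "finite (carrier Q)" and \<alpha>: "\<alpha> \<in> carrier P \<rightarrow> carrier Q"
    and mono: "\<And>x y. \<lbrakk>x \<in> carrier P; y \<in> carrier P; x \<sqsubseteq>\<^bsub>P\<^esub> y\<rbrakk> \<Longrightarrow> \<alpha> x \<sqsubseteq>\<^bsub>Q\<^esub> \<alpha> y"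
    and x: "x \<in> carrier P" and t: "t \<in> topspace (under_nerve P x)"
  shows "nerve_map P Q \<alpha> t \<in> topspace (under_nerve Q (\<alpha> x))"
  unfolding topspace_under_nerve_iff topspace_nerve_iff
proof (intro conjI ballI impI)
  show "nerve_map P Q \<alpha> t \<in> extensional (carrier Q)"
    by (simp add: nerve_map_def)
  show "0 \<le> nerve_map P Q \<alpha> t w" if "w \<in> carrier Q" for w
    using that t
    by (auto simp: nerve_map_def topspace_under_nerve_iff topspace_nerve_iff intro: sum_nonneg)
  show "(\<Sum>w\<in>carrier Q. nerve_map P Q \<alpha> t w) = 1"
    using t sum_nerve_map[OF fin \<alpha>] by (simp add: topspace_under_nerve_iff topspace_nerve_iff)
  show "w \<sqsubseteq>\<^bsub>Q\<^esub> w' \<or> w' \<sqsubseteq>\<^bsub>Q\<^esub> w"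
    if w: "w \<in> carrier Q" "w' \<in> carrier Q"
      and nz: "nerve_map P Q \<alpha> t w \<noteq> 0 \<and> nerve_map P Q \<alpha> t w' \<noteq> 0" for w w'
  proof -
    obtain a where "a \<in> carrier P" "\<alpha> a = w" "t a \<noteq> 0"
      using nerve_map_support[OF conjunct1[OF nz] w(1)] .
    moreover obtain b where "b \<in> carrier P" "\<alpha> b = w'" "t b \<noteq> 0"
      using nerve_map_support[OF conjunct2[OF nz] w(2)] .
    ultimately show ?thesis
      using t mono unfolding topspace_under_nerve_iff topspace_nerve_iff by metis
  qed
  show "\<alpha> x \<sqsubseteq>\<^bsub>Q\<^esub> w" if "w \<in> carrier Q" "nerve_map P Q \<alpha> t w \<noteq> 0" for w
    using nerve_map_support[OF that(2,1)] t mono x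
    unfolding topspace_under_nerve_iff by metis
qed

lemma continuous_map_nerve_map:
  assumes fin: "finite (carrier P)" "finite (carrier Q)" and \<alpha>: "\<alpha> \<in> carrier P \<rightarrow> carrier Q"
    and mono: "\<And>x y. \<lbrakk>x \<in> carrier P; y \<in> carrier P; x \<sqsubseteq>\<^bsub>P\<^esub> y\<rbrakk> \<Longrightarrow> \<alpha> x \<sqsubseteq>\<^bsub>Q\<^esub> \<alpha> y"
    and x: "x \<in> carrier P"
  shows "continuous_map (under_nerve P x) (under_nerve Q (\<alpha> x)) (nerve_map P Q \<alpha>)"
  unfolding continuous_map_into_under_nerve
proof (intro conjI ballI)
  show "nerve_map P Q \<alpha> \<in> topspace (under_nerve P x) \<rightarrow> topspace (under_nerve Q (\<alpha> x))"
    using nerve_map_in_under_nerve[OF assms] by blast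
  show "continuous_map (under_nerve P x) euclideanreal (\<lambda>t. nerve_map P Q \<alpha> t w)"
    if "w \<in> carrier Q" for w
    using that fin
    by (auto simp: nerve_map_def intro!: continuous_map_sum continuous_map_under_nerve_coordinate)
qed

lemma nerve_map_compose:
  assumes "finite (carrier P)" "finite (carrier Q)" "\<alpha> \<in> carrier P \<rightarrow> carrier Q"
  shows "nerve_map Q R \<beta> (nerve_map P Q \<alpha> t) = nerve_map P R (\<beta> \<circ> \<alpha>) t"
proof
  fix u
  have "(\<Sum>w | w \<in> carrier Q \<and> \<beta> w = u. nerve_map P Q \<alpha> t w)
      = (\<Sum>w | w \<in> carrier Q \<and> \<beta> w = u. \<Sum>x | x \<in> carrier P \<and> \<alpha> x = w. t x)"
    by (intro sum.cong refl) (simp add: nerve_map_def)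
  also have "(\<Sum>w | w \<in> carrier Q \<and> \<beta> w = u. \<Sum>x | x \<in> carrier P \<and> \<alpha> x = w. t x)
      = (\<Sum>w | w \<in> carrier Q \<and> \<beta> w = u.
           \<Sum>x | x \<in> {x \<in> carrier P. \<beta> (\<alpha> x) = u} \<and> \<alpha> x = w. t x)"
    by (intro sum.cong refl) auto
  also have "\<dots> = (\<Sum>x | x \<in> carrier P \<and> \<beta> (\<alpha> x) = u. t x)"
    by (rule sum.group) (use assms in auto)
  finally show "nerve_map Q R \<beta> (nerve_map P Q \<alpha> t) u = nerve_map P R (\<beta> \<circ> \<alpha>) t u"
    by (simp add: nerve_map_def[of Q R] nerve_map_def[of P R] restrict_def)
qed

lemma nerve_map_ident:
  assumes "t \<in> extensional (carrier P)" "\<And>x. x \<in> carrier P \<Longrightarrow> \<alpha> x = x"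
  shows "nerve_map P P \<alpha> t = t"
proof
  fix w
  have "{x \<in> carrier P. \<alpha> x = w} = {w}" if "w \<in> carrier P"
    using that assms(2) by auto
  then show "nerve_map P P \<alpha> t w = t w"
    using assms(1) by (auto simp: nerve_map_def extensional_def)
qed

section \<open>Homotopy colimits and the maps between them\<close>

locale top_diagram = partial_order P
  for P :: "'p gorder" (structure) and F :: "'p \<Rightarrow> 'b topology" and f :: "'p \<Rightarrow> 'p \<Rightarrow> 'b \<Rightarrow> 'b" +
  assumes finite_carrier: "finite (carrier P)"
    and continuous_structure_map:
      "\<lbrakk>x \<in> carrier P; y \<in> carrier P; x \<sqsubseteq> y\<rbrakk> \<Longrightarrow> continuous_map (F x) (F y) (f x y)"
    and structure_map_refl: "\<lbrakk>x \<in> carrier P; p \<in> topspace (F x)\<rbrakk> \<Longrightarrow> f x x p = p"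
    and structure_map_trans:
      "\<lbrakk>x \<in> carrier P; y \<in> carrier P; z \<in> carrier P; x \<sqsubseteq> y; y \<sqsubseteq> z; p \<in> topspace (F x)\<rbrakk>
        \<Longrightarrow> f y z (f x y p) = f x z p"
begin

lemma structure_map_closed:
  "\<lbrakk>x \<in> carrier P; y \<in> carrier P; x \<sqsubseteq> y; p \<in> topspace (F x)\<rbrakk> \<Longrightarrow> f x y p \<in> topspace (F y)"
  by (rule funcset_mem[OF continuous_map_funspace[OF continuous_structure_map]])

end

text \<open>The disjoint union of which the homotopy colimit is a quotient.\<close>

definition hocolim_sum where
  "hocolim_sum P F = sum_topology (\<lambda>x. prod_topology (F x) (under_nerve P x)) (carrier P)"

lemma mem_hocolim_sum [simp]:
  "(x, p, t) \<in> topspace (hocolim_sum P F) \<longleftrightarrow>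
     x \<in> carrier P \<and> p \<in> topspace (F x) \<and> t \<in> topspace (under_nerve P x)"
  by (auto simp: hocolim_sum_def)

abbreviation hocolim_point where
  "hocolim_point P F f a \<equiv> hocolim_rel P F f `` {a}"

lemma equiv_hocolim_rel: "equiv UNIV (hocolim_rel P F f)"
  unfolding hocolim_rel_def
  by (intro equivI refl_rtrancl sym_rtrancl sym_Un_converse trans_rtrancl)
     (auto simp: refl_on_def)

lemma hocolim_point_eq_iff:
  "hocolim_point P F f a = hocolim_point P F f b \<longleftrightarrow> (a, b) \<in> hocolim_rel P F f"
  by (rule eq_equiv_class_iff[OF equiv_hocolim_rel]) auto

lemma hocolim_point_glue:
  assumes "x \<in> carrier P" "y \<in> carrier P" "x \<sqsubseteq>\<^bsub>P\<^esub> y" "p \<in> topspace (F x)"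
    "t \<in> topspace (under_nerve P y)"
  shows "hocolim_point P F f (x, p, t) = hocolim_point P F f (y, f x y p, t)"
proof -
  have "((x, p, t), (y, f x y p, t)) \<in> hocolim_rel P F f"
    unfolding hocolim_rel_def hocolim_glue_def using assms by (intro r_into_rtrancl) blast
  then show ?thesis
    by (simp only: hocolim_point_eq_iff)
qed

text \<open>Reduces well-definedness of maps and homotopies on a homotopy colimit to the generating gluings.\<close>

lemma hocolim_rel_respects:
  assumes "\<And>x y p t. \<lbrakk>x \<in> carrier P; y \<in> carrier P; x \<sqsubseteq>\<^bsub>P\<^esub> y; p \<in> topspace (F x);
      t \<in> topspace (under_nerve P y)\<rbrakk> \<Longrightarrow> h (x, p, t) = h (y, f x y p, t)"
    and "hocolim_point P F f a = hocolim_point P F f b"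
  shows "h a = h b"
proof -
  have "(a, b) \<in> (hocolim_glue P F f \<union> (hocolim_glue P F f)\<inverse>)\<^sup>*"
    using assms(2) unfolding hocolim_point_eq_iff unfolding hocolim_rel_def .
  then show ?thesis
  proof (induction rule: rtrancl_induct)
    case (step b c)
    then show ?case
      using assms(1) unfolding hocolim_glue_def by (auto 0 3)
  qed simp
qed

lemma quotient_map_hocolim_point:
  "quotient_map (hocolim_sum P F) (hocolim P F f) (hocolim_point P F f)"
  unfolding hocolim_def hocolim_sum_def by (rule quotient_map_quotient_space)

lemma topspace_hocolim:
  "topspace (hocolim P F f) = hocolim_point P F f ` topspace (hocolim_sum P F)"
  using quotient_imp_surjective_map[OF quotient_map_hocolim_point] by metis

lemma hocolim_cases:
  assumes "u \<in> topspace (hocolim P F f)"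
  obtains x p t where "u = hocolim_point P F f (x, p, t)" "x \<in> carrier P" "p \<in> topspace (F x)"
    "t \<in> topspace (under_nerve P x)"
proof -
  obtain a where a: "u = hocolim_point P F f a" "a \<in> topspace (hocolim_sum P F)"
    using assms unfolding topspace_hocolim by blast
  obtain x p t where "a = (x, p, t)"
    by (rule prod_cases3)
  with a show thesis
    by (intro that[of x p t]) simp_all
qed

lemma continuous_map_hocolim_point:
  assumes "x \<in> carrier P"
  shows "continuous_map (prod_topology (F x) (under_nerve P x)) (hocolim P F f)
           (\<lambda>(p, t). hocolim_point P F f (x, p, t))"
  using quotient_imp_continuous_map[OF quotient_map_hocolim_point[of P F f]] assms
  by (auto simp: hocolim_sum_def continuous_map_sum_topology case_prod_unfold)

text \<open>
  A morphism of diagrams over a change of index poset: a monotone map \<open>\<alpha>\<close> together with a natural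
  transformation \<open>\<eta>\<close> from \<open>F\<close> to \<open>G \<circ> \<alpha>\<close>.
\<close>

locale diagram_map = P: top_diagram P F f + Q: top_diagram Q G g
  for P :: "'p gorder" and F :: "'p \<Rightarrow> 'b topology" and f :: "'p \<Rightarrow> 'p \<Rightarrow> 'b \<Rightarrow> 'b"
    and Q :: "'q gorder" and G :: "'q \<Rightarrow> 'c topology" and g :: "'q \<Rightarrow> 'q \<Rightarrow> 'c \<Rightarrow> 'c" +
  fixes \<alpha> :: "'p \<Rightarrow> 'q" and \<eta> :: "'p \<Rightarrow> 'b \<Rightarrow> 'c"
  assumes closed: "\<alpha> \<in> carrier P \<rightarrow> carrier Q"
    and mono: "\<lbrakk>x \<in> carrier P; y \<in> carrier P; x \<sqsubseteq>\<^bsub>P\<^esub> y\<rbrakk> \<Longrightarrow> \<alpha> x \<sqsubseteq>\<^bsub>Q\<^esub> \<alpha> y"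
    and continuous: "x \<in> carrier P \<Longrightarrow> continuous_map (F x) (G (\<alpha> x)) (\<eta> x)"
    and natural: "\<lbrakk>x \<in> carrier P; y \<in> carrier P; x \<sqsubseteq>\<^bsub>P\<^esub> y; p \<in> topspace (F x)\<rbrakk>
      \<Longrightarrow> \<eta> y (f x y p) = g (\<alpha> x) (\<alpha> y) (\<eta> x p)"
begin

lemmas nerve_map_closed =
  nerve_map_in_under_nerve[OF P.finite_carrier Q.finite_carrier closed mono]

lemma component_closed: "\<lbrakk>x \<in> carrier P; p \<in> topspace (F x)\<rbrakk> \<Longrightarrow> \<eta> x p \<in> topspace (G (\<alpha> x))"
  by (rule funcset_mem[OF continuous_map_funspace[OF continuous]])

lemma hocolim_map_point:
  assumes "(x, p, t) \<in> topspace (hocolim_sum P F)"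
  shows "hocolim_map P Q G g \<alpha> \<eta> (hocolim_point P F f (x, p, t)) =
           hocolim_point Q G g (\<alpha> x, \<eta> x p, nerve_map P Q \<alpha> t)"
proof -
  define h where "h = (\<lambda>(x, p, t). hocolim_point Q G g (\<alpha> x, \<eta> x p, nerve_map P Q \<alpha> t))"
  have h: "h (x, p, t) = h (y, f x y p, t)"
    if "x \<in> carrier P" "y \<in> carrier P" "x \<sqsubseteq>\<^bsub>P\<^esub> y" "p \<in> topspace (F x)"
      "t \<in> topspace (under_nerve P y)" for x y p t
  proof -
    have "hocolim_point Q G g (\<alpha> x, \<eta> x p, nerve_map P Q \<alpha> t) =
        hocolim_point Q G g (\<alpha> y, g (\<alpha> x) (\<alpha> y) (\<eta> x p), nerve_map P Q \<alpha> t)"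
      using that closed
      by (intro hocolim_point_glue mono component_closed nerve_map_closed) auto
    then show ?thesis
      using that by (simp only: h_def natural prod.case)
  qed
  have "h a = h (x, p, t)" if "a \<in> hocolim_point P F f (x, p, t)" for a
  proof (rule hocolim_rel_respects[where h = h, OF h])
    show "hocolim_point P F f a = hocolim_point P F f (x, p, t)"
      by (rule hocolim_point_eq_iff[of P F f "(x, p, t)" a, THEN iffD2, symmetric])
        (rule that[unfolded Image_singleton_iff])
  qed
  moreover have "(x, p, t) \<in> hocolim_point P F f (x, p, t)"
    by (rule equiv_class_self[OF equiv_hocolim_rel UNIV_I])
  ultimately have "(\<Union>a\<in>hocolim_point P F f (x, p, t). h a) = h (x, p, t)"
    by blast
  then show ?thesis
    by (simp only: hocolim_map_def h_def prod.case)
qed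

lemma continuous_map_hocolim_map:
  "continuous_map (hocolim P F f) (hocolim Q G g) (hocolim_map P Q G g \<alpha> \<eta>)"
proof (rule continuous_compose_quotient_map[OF quotient_map_hocolim_point])
  have "continuous_map (prod_topology (F x) (under_nerve P x)) (hocolim Q G g)
          (\<lambda>a. hocolim_point Q G g (\<alpha> x, \<eta> x (fst a), nerve_map P Q \<alpha> (snd a)))"
    if x: "x \<in> carrier P" for x
  proof -
    have "continuous_map (prod_topology (F x) (under_nerve P x))
            (prod_topology (G (\<alpha> x)) (under_nerve Q (\<alpha> x)))
            (\<lambda>(p, t). (\<eta> x p, nerve_map P Q \<alpha> t))"
      unfolding continuous_map_prod_top
      using continuous[OF x]
        continuous_map_nerve_map[OF P.finite_carrier Q.finite_carrier closed mono x] by blast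
    from continuous_map_compose[OF this continuous_map_hocolim_point[of "\<alpha> x" Q G g]]
    show ?thesis
      using x closed by (auto simp: o_def case_prod_unfold)
  qed
  then have "continuous_map (hocolim_sum P F) (hocolim Q G g)
      (\<lambda>(x, p, t). hocolim_point Q G g (\<alpha> x, \<eta> x p, nerve_map P Q \<alpha> t))"
    by (simp add: hocolim_sum_def continuous_map_sum_topology case_prod_unfold)
  then show "continuous_map (hocolim_sum P F) (hocolim Q G g)
      (hocolim_map P Q G g \<alpha> \<eta> \<circ> hocolim_point P F f)"
  proof (rule continuous_map_eq)
    fix a assume "a \<in> topspace (hocolim_sum P F)"
    then show "(\<lambda>(x, p, t). hocolim_point Q G g (\<alpha> x, \<eta> x p, nerve_map P Q \<alpha> t)) a =
        (hocolim_map P Q G g \<alpha> \<eta> \<circ> hocolim_point P F f) a"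
      using hocolim_map_point[of "fst a" "fst (snd a)" "snd (snd a)"]
      by (simp only: case_prod_unfold prod.collapse o_apply)
  qed
qed

end

text \<open>
  Homotopies out of a homotopy colimit are given on the disjoint union. The reason is that the product
  of a quotient map with the identity of the unit interval is again a quotient map, the interval being
  locally compact and Hausdorff.
\<close>

lemma homotopic_with_hocolim:
  assumes cont: "\<And>x. x \<in> carrier P \<Longrightarrow>
      continuous_map (prod_topology (top_of_set {0..1}) (prod_topology (F x) (under_nerve P x))) Y
        (\<lambda>(r, p, t). h r (x, p, t))"
    and glue: "\<And>r x y p t. \<lbrakk>r \<in> {0..1}; x \<in> carrier P; y \<in> carrier P; x \<sqsubseteq>\<^bsub>P\<^esub> y;
      p \<in> topspace (F x); t \<in> topspace (under_nerve P y)\<rbrakk> \<Longrightarrow> h r (x, p, t) = h r (y, f x y p, t)"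
    and h0: "\<And>a. a \<in> topspace (hocolim_sum P F) \<Longrightarrow> h 0 a = k0 (hocolim_point P F f a)"
    and h1: "\<And>a. a \<in> topspace (hocolim_sum P F) \<Longrightarrow> h (1::real) a = k1 (hocolim_point P F f a)"
  shows "homotopic_with (\<lambda>_. True) (hocolim P F f) Y k0 k1"
proof -
  let ?I = "top_of_set {0..1::real}"
  let ?q = "hocolim_point P F f"
  have "compact_space ?I"
    by (simp add: compact_space_subtopology)
  then have q: "quotient_map (prod_topology ?I (hocolim_sum P F)) (prod_topology ?I (hocolim P F f))
      (\<lambda>(r, a). (r, ?q a))"
    by (intro quotient_map_prod_right quotient_map_hocolim_point compact_imp_locally_compact_space
        disjI1 Hausdorff_space_subtopology Hausdorff_space_euclidean)
  have c: "continuous_map (prod_topology ?I (hocolim_sum P F)) Y (\<lambda>(r, a). h r a)"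
    using cont by (simp add: hocolim_sum_def continuous_map_prod_sum_topology case_prod_unfold)
  let ?h = "\<lambda>(r, a). h r a" and ?Q = "\<lambda>(r, a). (r, ?q a)"
  have respects: "?h u = ?h v"
    if u: "u \<in> topspace (prod_topology ?I (hocolim_sum P F))"
       "v \<in> topspace (prod_topology ?I (hocolim_sum P F))"
       and eq: "?Q u = ?Q v" for u v
  proof -
    obtain r a b where uv: "u = (r, a)" "v = (r, b)" "r \<in> {0..1}"
    proof
      show "u = (fst u, snd u)"
        by simp
      show "v = (fst u, snd v)" "fst u \<in> {0..1}"
        using eq u(1) by (cases u; cases v; simp only: prod.case prod.inject fst_conv snd_conv
            topspace_prod_topology topspace_euclidean_subtopology mem_Sigma_iff)+
    qed
    have "?q a = ?q b"
      using eq by (simp only: uv prod.case prod.inject)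
    from hocolim_rel_respects[where h = "h r", OF glue[OF uv(3)] this]
    show ?thesis
      by (simp only: uv prod.case)
  qed
  obtain H where H: "continuous_map (prod_topology ?I (hocolim P F f)) Y H"
    and Heq: "\<And>u. u \<in> topspace (prod_topology ?I (hocolim_sum P F)) \<Longrightarrow>
       H (?Q u) = ?h u"
  proof (rule quotient_map_lift_exists[OF q c])
    show "?h u = ?h v"
      if "u \<in> topspace (prod_topology ?I (hocolim_sum P F))"
        "v \<in> topspace (prod_topology ?I (hocolim_sum P F))" "?Q u = ?Q v" for u v
      using that by (rule respects)
    fix H
    assume "continuous_map (prod_topology ?I (hocolim P F f)) Y H"
      and "\<And>u. u \<in> topspace (prod_topology ?I (hocolim_sum P F)) \<Longrightarrow> H (?Q u) = ?h u"
    then show thesis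
      by (rule that)
  qed
  have H01: "H (0, c) = k0 c" "H (1, c) = k1 c" if c: "c \<in> topspace (hocolim P F f)" for c
  proof -
    obtain a where a: "a \<in> topspace (hocolim_sum P F)" "c = ?q a"
      using c unfolding topspace_hocolim by blast
    have "H (r, ?q a) = h r a" if "r \<in> {0..1}" for r
    proof -
      have "(r, a) \<in> topspace (prod_topology ?I (hocolim_sum P F))"
        using that a(1) by (simp only: topspace_prod_topology topspace_euclidean_subtopology mem_Sigma_iff)
      from Heq[OF this] show ?thesis
        by (simp only: prod.case)
    qed
    then have "H (0, ?q a) = h 0 a" "H (1, ?q a) = h 1 a"
      by simp_all
    then show "H (0, c) = k0 c" "H (1, c) = k1 c"
      by (simp_all only: a(2) h0[OF a(1)] h1[OF a(1)])
  qed
  show ?thesis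
    by (rule homotopic_with[THEN iffD2], simp, rule exI[of _ H]) (intro conjI ballI H H01 TrueI)
qed

section \<open>Poset maps above the identity\<close>

text \<open>
  Let \<open>\<alpha>\<close> be a monotone self-map with \<open>c \<sqsubseteq> \<alpha> c\<close>. The straight line from a point \<open>t\<close> of the nerve to its
  image under \<open>\<alpha>\<close> leaves the nerve, because for \<open>c \<sqsubseteq> d\<close> the elements \<open>\<alpha> c\<close> and \<open>d\<close> need not be
  comparable. Moving the mass from the top of the chain downwards avoids this: if the part of
  \<open>c\<^sub>0 \<sqsubseteq> \<dots> \<sqsubseteq> c\<^sub>n\<close> above \<open>c\<^sub>k\<close> has been moved and \<open>c\<^sub>k\<close> is being moved, the support is contained in
  \<open>c\<^sub>0 \<sqsubseteq> \<dots> \<sqsubseteq> c\<^sub>k \<sqsubseteq> \<alpha> c\<^sub>k \<sqsubseteq> \<dots> \<sqsubseteq> \<alpha> c\<^sub>n\<close>. At time \<open>r\<close> the total mass that has been moved is \<open>r\<close>.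
\<close>

definition mass_above :: "'q gorder \<Rightarrow> ('q \<Rightarrow> real) \<Rightarrow> 'q \<Rightarrow> real" where
  "mass_above Q t c = (\<Sum>d | d \<in> carrier Q \<and> c \<sqsubseteq>\<^bsub>Q\<^esub> d \<and> d \<noteq> c. t d)"

text \<open>
  The part of the mass at \<open>c\<close> that belongs to the topmost mass \<open>r\<close> of the chain. The formula is
  continuous in \<open>r\<close> and \<open>t\<close> and does not refer to an enumeration of the chain.
\<close>

definition top_mass :: "'q gorder \<Rightarrow> real \<Rightarrow> ('q \<Rightarrow> real) \<Rightarrow> 'q \<Rightarrow> real" where
  "top_mass Q r t c = max 0 (min (t c) (r - mass_above Q t c))"

definition push_up :: "'q gorder \<Rightarrow> ('q \<Rightarrow> 'q) \<Rightarrow> real \<Rightarrow> ('q \<Rightarrow> real) \<Rightarrow> 'q \<Rightarrow> real" where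
  "push_up Q \<alpha> r t =
     (\<lambda>d\<in>carrier Q. t d - top_mass Q r t d + nerve_map Q Q \<alpha> (top_mass Q r t) d)"

locale inflationary_map = top_diagram Q G g
  for Q :: "'q gorder" (structure) and G :: "'q \<Rightarrow> 'c topology" and g :: "'q \<Rightarrow> 'q \<Rightarrow> 'c \<Rightarrow> 'c" +
  fixes \<alpha> :: "'q \<Rightarrow> 'q"
  assumes closed: "\<alpha> \<in> carrier Q \<rightarrow> carrier Q"
    and mono: "\<lbrakk>x \<in> carrier Q; y \<in> carrier Q; x \<sqsubseteq> y\<rbrakk> \<Longrightarrow> \<alpha> x \<sqsubseteq> \<alpha> y"
    and inflationary: "x \<in> carrier Q \<Longrightarrow> x \<sqsubseteq> \<alpha> x"
begin

lemma top_mass_bounds: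
  assumes "t \<in> topspace (nerve Q)" "c \<in> carrier Q"
  shows "0 \<le> top_mass Q r t c" "top_mass Q r t c \<le> t c"
  using assms by (auto simp: top_mass_def topspace_nerve_iff)

lemma top_mass_0:
  assumes "t \<in> topspace (nerve Q)" "c \<in> carrier Q"
  shows "top_mass Q 0 t c = 0"
proof -
  have "0 \<le> mass_above Q t c"
    using assms unfolding mass_above_def topspace_nerve_iff by (intro sum_nonneg) auto
  then show ?thesis
    by (simp add: top_mass_def)
qed

lemma top_mass_1:
  assumes t: "t \<in> topspace (nerve Q)" and c: "c \<in> carrier Q"
  shows "top_mass Q 1 t c = t c"
proof -
  have "mass_above Q t c \<le> sum t (carrier Q - {c})"
    using t finite_carrier unfolding mass_above_def topspace_nerve_iff
    by (intro sum_mono2) auto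
  also have "\<dots> = 1 - t c"
    using t c finite_carrier by (simp add: sum_diff1 topspace_nerve_iff)
  finally show ?thesis
    using t c by (simp add: top_mass_def topspace_nerve_iff)
qed

text \<open>
  Mass is taken from \<open>c\<close> only when all the mass above \<open>c\<close> has been taken. This is what keeps the support
  of \<open>push_up\<close> a chain.
\<close>

lemma top_mass_saturated_above:
  assumes t: "t \<in> topspace (nerve Q)" and cd: "c \<in> carrier Q" "d \<in> carrier Q" "c \<sqsubseteq> d" "c \<noteq> d"
    and pos: "top_mass Q r t c \<noteq> 0"
  shows "top_mass Q r t d = t d"
proof -
  let ?above = "\<lambda>c. {e \<in> carrier Q. c \<sqsubseteq> e \<and> e \<noteq> c}"
  have "insert d (?above d) \<subseteq> ?above c"
    using cd le_trans le_antisym by blast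
  then have "sum t (insert d (?above d)) \<le> sum t (?above c)"
    using t finite_carrier by (intro sum_mono2) (auto simp: topspace_nerve_iff)
  then have "t d + mass_above Q t d \<le> mass_above Q t c"
    using finite_carrier by (simp add: mass_above_def)
  moreover have "mass_above Q t c < r"
    using pos by (auto simp: top_mass_def max_def split: if_splits)
  moreover have "0 \<le> t d"
    using t cd by (simp add: topspace_nerve_iff)
  ultimately show ?thesis
    by (simp add: top_mass_def)
qed

lemma push_up_support:
  assumes t: "t \<in> topspace (nerve Q)" and w: "w \<in> carrier Q" "push_up Q \<alpha> r t w \<noteq> 0"
  shows "top_mass Q r t w \<noteq> t w \<or> (\<exists>c\<in>carrier Q. w = \<alpha> c \<and> top_mass Q r t c \<noteq> 0)"
proof (rule disjCI)
  assume "\<not> (\<exists>c\<in>carrier Q. w = \<alpha> c \<and> top_mass Q r t c \<noteq> 0)"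
  then have "nerve_map Q Q \<alpha> (top_mass Q r t) w = 0"
    using w(1) by (auto simp: nerve_map_def intro: sum.neutral)
  then show "top_mass Q r t w \<noteq> t w"
    using w by (simp add: push_up_def)
qed

lemma push_up_in_under_nerve:
  assumes x: "x \<in> carrier Q" and t: "t \<in> topspace (under_nerve Q x)"
  shows "push_up Q \<alpha> r t \<in> topspace (under_nerve Q x)"
proof -
  let ?m = "top_mass Q r t"
  have n: "t \<in> topspace (nerve Q)"
    using t by (simp add: topspace_under_nerve_iff)
  have m0: "t c \<noteq> 0" if "c \<in> carrier Q" "?m c \<noteq> 0 \<or> ?m c \<noteq> t c" for c
    using top_mass_bounds[OF n that(1), of r] that(2) by auto
  have chain: "c \<sqsubseteq> d \<or> d \<sqsubseteq> c" if "c \<in> carrier Q" "d \<in> carrier Q" "t c \<noteq> 0" "t d \<noteq> 0" for c d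
    using n that by (auto simp: topspace_nerve_iff)
  \<comment> \<open>The critical case: mass that stays at \<open>d\<close> and mass that moves from \<open>c\<close> to \<open>\<alpha> c\<close>. As \<open>d\<close> is not
    exhausted, it cannot lie strictly above \<open>c\<close>.\<close>
  have stay_move: "d \<sqsubseteq> \<alpha> c"
    if cd: "c \<in> carrier Q" "d \<in> carrier Q" and m: "?m c \<noteq> 0" "?m d \<noteq> t d" for c d
  proof -
    have "d \<sqsubseteq> c"
      using chain[OF cd] m0[OF cd(1)] m0[OF cd(2)] m top_mass_saturated_above[OF n cd _ _ m(1)]
        cd(1) le_refl by metis
    then show ?thesis
      by (rule le_trans[OF _ inflationary[OF cd(1)]]) (use cd closed in auto)
  qed
  show ?thesis
    unfolding topspace_under_nerve_iff[of "push_up Q \<alpha> r t"] topspace_nerve_iff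
  proof (intro conjI ballI impI)
    show "push_up Q \<alpha> r t \<in> extensional (carrier Q)"
      by (simp add: push_up_def)
    show "0 \<le> push_up Q \<alpha> r t w" if "w \<in> carrier Q" for w
      using that top_mass_bounds[OF n]
      by (auto simp: push_up_def nerve_map_def intro!: add_nonneg_nonneg sum_nonneg)
    show "(\<Sum>w\<in>carrier Q. push_up Q \<alpha> r t w) = 1"
      using sum_nerve_map[OF finite_carrier finite_carrier closed, of ?m] n
      by (simp add: push_up_def sum.distrib sum_subtractf topspace_nerve_iff)
    show "v \<sqsubseteq> w \<or> w \<sqsubseteq> v"
      if vw: "v \<in> carrier Q" "w \<in> carrier Q" "push_up Q \<alpha> r t v \<noteq> 0 \<and> push_up Q \<alpha> r t w \<noteq> 0" for v w
    proof -
      have v: "?m v \<noteq> t v \<or> (\<exists>c\<in>carrier Q. v = \<alpha> c \<and> ?m c \<noteq> 0)"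
        using push_up_support[OF n] vw by blast
      have w: "?m w \<noteq> t w \<or> (\<exists>c\<in>carrier Q. w = \<alpha> c \<and> ?m c \<noteq> 0)"
        using push_up_support[OF n] vw by blast
      have "\<alpha> c \<sqsubseteq> \<alpha> d \<or> \<alpha> d \<sqsubseteq> \<alpha> c"
        if "c \<in> carrier Q" "d \<in> carrier Q" "?m c \<noteq> 0" "?m d \<noteq> 0" for c d
        using chain[OF that(1,2)] m0 that mono by blast
      moreover have "v \<sqsubseteq> w \<or> w \<sqsubseteq> v" if "?m v \<noteq> t v" "?m w \<noteq> t w"
        using chain m0 vw that by blast
      ultimately show ?thesis
        using v w stay_move vw(1,2) by blast
    qed
    show "x \<sqsubseteq> w" if w: "w \<in> carrier Q" "push_up Q \<alpha> r t w \<noteq> 0" for w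
    proof -
      have x_le: "x \<sqsubseteq> c" if "c \<in> carrier Q" "?m c \<noteq> 0 \<or> ?m c \<noteq> t c" for c
        using t that m0[OF that] by (simp add: topspace_under_nerve_iff)
      show ?thesis
        using push_up_support[OF n w] x_le w(1) x inflationary le_trans by blast
    qed
  qed
qed

lemma continuous_map_push_up:
  assumes "x \<in> carrier Q"
  shows "continuous_map (prod_topology (top_of_set {0..1}) (under_nerve Q x)) (under_nerve Q x)
           (\<lambda>(r, t). push_up Q \<alpha> r t)"
  unfolding continuous_map_into_under_nerve
proof (intro conjI ballI)
  let ?Z = "prod_topology (top_of_set {0..1::real}) (under_nerve Q x)"
  show "(\<lambda>(r, t). push_up Q \<alpha> r t) \<in> topspace ?Z \<rightarrow> topspace (under_nerve Q x)"
    using push_up_in_under_nerve[OF assms] by auto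
  have r: "continuous_map ?Z euclideanreal fst"
    using continuous_map_fst[of "top_of_set {0..1}" "under_nerve Q x"] continuous_map_in_subtopology by blast
  have t: "continuous_map ?Z euclideanreal (\<lambda>z. snd z c)" if "c \<in> carrier Q" for c
    using continuous_map_compose[OF continuous_map_snd continuous_map_under_nerve_coordinate[OF that]]
    by (simp add: o_def)
  have m: "continuous_map ?Z euclideanreal (\<lambda>z. top_mass Q (fst z) (snd z) c)"
    if "c \<in> carrier Q" for c
    unfolding top_mass_def mass_above_def using that finite_carrier
    by (intro continuous_map_real_max continuous_map_real_min continuous_map_diff
        continuous_map_sum r t continuous_map_canonical_const) auto
  show "continuous_map ?Z euclideanreal (\<lambda>z. (case z of (r, t) \<Rightarrow> push_up Q \<alpha> r t) d)"
    if "d \<in> carrier Q" for d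
    using that finite_carrier
    by (auto simp: push_up_def nerve_map_def case_prod_unfold
        intro!: continuous_map_add continuous_map_diff continuous_map_sum m t)
qed

lemma diagram_map_inflationary: "diagram_map Q G g Q G g \<alpha> (\<lambda>c. g c (\<alpha> c))"
proof
  show "\<alpha> \<in> carrier Q \<rightarrow> carrier Q"
    by (rule closed)
  fix x y assume x: "x \<in> carrier Q"
  show "continuous_map (G x) (G (\<alpha> x)) (g x (\<alpha> x))"
    using x closed inflationary by (auto intro: continuous_structure_map)
  assume y: "y \<in> carrier Q" "x \<sqsubseteq> y"
  show "\<alpha> x \<sqsubseteq> \<alpha> y"
    using x y by (rule mono)
  fix p assume "p \<in> topspace (G x)"
  moreover have "\<alpha> x \<in> carrier Q" "\<alpha> y \<in> carrier Q"
    using closed x y by auto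
  ultimately show "g y (\<alpha> y) (g x y p) = g (\<alpha> x) (\<alpha> y) (g x (\<alpha> x) p)"
    using x y mono[of x y] inflationary by (simp add: structure_map_trans)
qed

text \<open>
  The homotopy moves only the nerve coordinate. It ends at \<open>[c, p, \<alpha>\<^sub>* t]\<close>, and the gluing along
  \<open>c \<sqsubseteq> \<alpha> c\<close> identifies this point with \<open>[\<alpha> c, g c (\<alpha> c) p, \<alpha>\<^sub>* t]\<close>, its image under the induced map.
\<close>

lemma homotopic_hocolim_map_inflationary:
  "homotopic_with (\<lambda>_. True) (hocolim Q G g) (hocolim Q G g)
     id (hocolim_map Q Q G g \<alpha> (\<lambda>c. g c (\<alpha> c)))"
proof (rule homotopic_with_hocolim[where h = "\<lambda>r (c, p, t). hocolim_point Q G g (c, p, push_up Q \<alpha> r t)"])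
  interpret diagram_map Q G g Q G g \<alpha> "\<lambda>c. g c (\<alpha> c)"
    by (rule diagram_map_inflationary)
  let ?I = "top_of_set {0..1::real}"
  show "continuous_map (prod_topology ?I (prod_topology (G x) (under_nerve Q x))) (hocolim Q G g)
      (\<lambda>(r, p, t). case (x, p, t) of (c, p, t) \<Rightarrow> hocolim_point Q G g (c, p, push_up Q \<alpha> r t))"
    if x: "x \<in> carrier Q" for x
  proof -
    let ?Z = "prod_topology ?I (prod_topology (G x) (under_nerve Q x))"
    have "continuous_map ?Z (prod_topology ?I (under_nerve Q x)) (\<lambda>z. (fst z, snd (snd z)))"
      by (intro continuous_map_pairedI continuous_map_fst
          continuous_map_snd_of[OF continuous_map_snd, unfolded o_def])
    from continuous_map_compose[OF this continuous_map_push_up[OF x]]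
    have "continuous_map ?Z (under_nerve Q x) (\<lambda>z. push_up Q \<alpha> (fst z) (snd (snd z)))"
      by (simp add: o_def)
    then have "continuous_map ?Z (prod_topology (G x) (under_nerve Q x))
        (\<lambda>z. (fst (snd z), push_up Q \<alpha> (fst z) (snd (snd z))))"
      by (intro continuous_map_pairedI continuous_map_fst_of[OF continuous_map_snd, unfolded o_def])
    from continuous_map_compose[OF this continuous_map_hocolim_point[of x Q G g, OF x]]
    show ?thesis
      by (simp add: o_def case_prod_unfold)
  qed
  show "(case (x, p, t) of (c, p, t) \<Rightarrow> hocolim_point Q G g (c, p, push_up Q \<alpha> r t)) =
        (case (y, g x y p, t) of (c, p, t) \<Rightarrow> hocolim_point Q G g (c, p, push_up Q \<alpha> r t))"
    if "x \<in> carrier Q" "y \<in> carrier Q" "x \<sqsubseteq> y" "p \<in> topspace (G x)" "t \<in> topspace (under_nerve Q y)"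
    for r x y p t
    using that push_up_in_under_nerve
    by (simp only: prod.case) (intro hocolim_point_glue)
  fix a assume a: "a \<in> topspace (hocolim_sum Q G)"
  obtain c p t where cpt: "a = (c, p, t)" "c \<in> carrier Q" "p \<in> topspace (G c)"
    "t \<in> topspace (under_nerve Q c)"
    using a by (cases a) simp
  have n: "t \<in> topspace (nerve Q)" and ext: "t \<in> extensional (carrier Q)"
    using cpt(4) by (simp_all add: topspace_under_nerve_iff topspace_nerve_iff)
  have "push_up Q \<alpha> 0 t = t"
    using ext by (intro extensionalityI[of _ "carrier Q"])
       (auto simp: push_up_def nerve_map_def top_mass_0[OF n] intro!: sum.neutral)
  then show "(case a of (c, p, t) \<Rightarrow> hocolim_point Q G g (c, p, push_up Q \<alpha> 0 t)) =
      id (hocolim_point Q G g a)"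
    by (simp only: cpt prod.case id_apply)
  have "push_up Q \<alpha> 1 t = nerve_map Q Q \<alpha> t"
    by (intro extensionalityI[of _ "carrier Q"])
       (auto simp: push_up_def nerve_map_def top_mass_1[OF n] intro!: sum.cong)
  moreover have "hocolim_point Q G g (c, p, nerve_map Q Q \<alpha> t) =
      hocolim_point Q G g (\<alpha> c, g c (\<alpha> c) p, nerve_map Q Q \<alpha> t)"
    using cpt closed by (intro hocolim_point_glue inflationary nerve_map_closed) auto
  ultimately show "(case a of (c, p, t) \<Rightarrow> hocolim_point Q G g (c, p, push_up Q \<alpha> 1 t)) =
      hocolim_map Q Q G g \<alpha> (\<lambda>c. g c (\<alpha> c)) (hocolim_point Q G g a)"
    using a by (simp only: cpt prod.case hocolim_map_point)
qed

end

section \<open>Galois retractions and homotopy colimits\<close>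

text \<open>
  The map in the other direction is built from \<open>l\<close> and the composites
  \<open>G c \<rightarrow> G (s (l c)) \<cong> F (l c)\<close>, called \<open>\<zeta>\<close> in the proof.
\<close>

lemma homotopy_equivalence_hocolim_map:
  fixes P :: "'p gorder" and Q :: "'q gorder"
  assumes s: "diagram_map P F f Q G g s \<theta>"
    and l: "l \<in> carrier Q \<rightarrow> carrier P"
    and l_mono: "\<And>c d. \<lbrakk>c \<in> carrier Q; d \<in> carrier Q; c \<sqsubseteq>\<^bsub>Q\<^esub> d\<rbrakk> \<Longrightarrow> l c \<sqsubseteq>\<^bsub>P\<^esub> l d"
    and l_s: "\<And>x. x \<in> carrier P \<Longrightarrow> l (s x) = x"
    and unit: "\<And>c. c \<in> carrier Q \<Longrightarrow> c \<sqsubseteq>\<^bsub>Q\<^esub> s (l c)"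
    and iso: "\<And>x. x \<in> carrier P \<Longrightarrow> homeomorphic_maps (F x) (G (s x)) (\<theta> x) (\<psi> x)"
  shows "homotopy_equivalence (hocolim P F f) (hocolim Q G g) (hocolim_map P Q G g s \<theta>)"
proof -
  interpret s: diagram_map P F f Q G g s \<theta>
    by (rule s)
  interpret sl: inflationary_map Q G g "s \<circ> l"
    using l l_mono unit s.closed s.mono by unfold_locales (auto simp: Pi_iff)
  define \<zeta> where "\<zeta> c p = \<psi> (l c) (g c (s (l c)) p)" for c p
  have \<theta>\<psi>: "\<theta> x (\<psi> x q) = q" if "x \<in> carrier P" "q \<in> topspace (G (s x))" for x q
    using iso that by (simp add: homeomorphic_maps_def)
  have \<psi>\<theta>: "\<psi> x (\<theta> x p) = p" if "x \<in> carrier P" "p \<in> topspace (F x)" for x p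
    using iso that by (simp add: homeomorphic_maps_def)
  have lc: "l c \<in> carrier P" "s (l c) \<in> carrier Q" if "c \<in> carrier Q" for c
    using l s.closed that by auto
  have \<psi>_cont: "continuous_map (G (s x)) (F x) (\<psi> x)" if "x \<in> carrier P" for x
    using iso that by (simp add: homeomorphic_maps_def)
  have \<psi>_closed: "\<psi> x q \<in> topspace (F x)" if "x \<in> carrier P" "q \<in> topspace (G (s x))" for x q
    using that by (intro funcset_mem[OF continuous_map_funspace[OF \<psi>_cont]])
  interpret l: diagram_map Q G g P F f l \<zeta>
  proof
    show "l \<in> carrier Q \<rightarrow> carrier P"
      by (rule l)
    fix c d assume c: "c \<in> carrier Q"
    show "continuous_map (G c) (F (l c)) (\<zeta> c)"
      using continuous_map_compose[OF s.Q.continuous_structure_map \<psi>_cont] c lc unit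
      by (simp add: \<zeta>_def[abs_def] o_def)
    assume d: "d \<in> carrier Q" "c \<sqsubseteq>\<^bsub>Q\<^esub> d"
    then show le: "l c \<sqsubseteq>\<^bsub>P\<^esub> l d"
      using c l_mono by blast
    fix p assume p: "p \<in> topspace (G c)"
    let ?q = "g c (s (l c)) p"
    have q: "?q \<in> topspace (G (s (l c)))"
      using c lc unit p by (simp add: s.Q.structure_map_closed)
    have "\<theta> (l d) (f (l c) (l d) (\<psi> (l c) ?q)) = g (s (l c)) (s (l d)) ?q"
      using c d lc le q by (simp add: s.natural \<psi>_closed \<theta>\<psi>)
    also have "\<dots> = g d (s (l d)) (g c d p)"
      using c d lc unit s.mono[OF _ _ le] p by (simp add: s.Q.structure_map_trans)
    finally have "\<psi> (l d) (\<theta> (l d) (f (l c) (l d) (\<psi> (l c) ?q))) = \<zeta> d (g c d p)"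
      by (simp add: \<zeta>_def)
    then show "\<zeta> d (g c d p) = f (l c) (l d) (\<zeta> c p)"
      using c d lc le q by (simp add: \<zeta>_def \<psi>\<theta> \<psi>_closed s.P.structure_map_closed)
  qed
  let ?S = "hocolim_map P Q G g s \<theta>" and ?L = "hocolim_map Q P F f l \<zeta>"
  have "(?L \<circ> ?S) u = id u" if "u \<in> topspace (hocolim P F f)" for u
  proof -
    obtain x p t where u: "u = hocolim_point P F f (x, p, t)"
      and xpt: "x \<in> carrier P" "p \<in> topspace (F x)" "t \<in> topspace (under_nerve P x)"
      using \<open>u \<in> topspace (hocolim P F f)\<close> by (rule hocolim_cases)
    have "(x, p, t) \<in> topspace (hocolim_sum P F)"
      using xpt by simp
    moreover    have "(s x, \<theta> x p, nerve_map P Q s t) \<in> topspace (hocolim_sum Q G)"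
      using xpt s.closed by (auto intro: s.component_closed s.nerve_map_closed)
    ultimately have "?L (?S u) =
        hocolim_point P F f (l (s x), \<zeta> (s x) (\<theta> x p), nerve_map Q P l (nerve_map P Q s t))"
      by (simp only: u s.hocolim_map_point l.hocolim_map_point)
    moreover have "\<zeta> (s x) (\<theta> x p) = p"
      using xpt funcset_mem[OF s.closed xpt(1)]
      by (simp add: \<zeta>_def l_s s.Q.structure_map_refl s.component_closed \<psi>\<theta>)
    moreover have "nerve_map Q P l (nerve_map P Q s t) = t"
      using xpt s.P.finite_carrier s.Q.finite_carrier s.closed l_s
      by (auto simp: nerve_map_compose topspace_under_nerve_iff topspace_nerve_iff
          intro: nerve_map_ident)
    ultimately show ?thesis
      by (simp only: o_apply id_apply l_s[OF xpt(1)] u)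
  qed
  then have 1: "homotopic_with (\<lambda>_. True) (hocolim P F f) (hocolim P F f) (?L \<circ> ?S) id"
    using continuous_map_compose[OF s.continuous_map_hocolim_map l.continuous_map_hocolim_map]
    by (intro homotopic_with_equal TrueI)
  have "(?S \<circ> ?L) u = hocolim_map Q Q G g (s \<circ> l) (\<lambda>c. g c ((s \<circ> l) c)) u"
    if "u \<in> topspace (hocolim Q G g)" for u
  proof -
    obtain c p t where u: "u = hocolim_point Q G g (c, p, t)"
      and cpt: "c \<in> carrier Q" "p \<in> topspace (G c)" "t \<in> topspace (under_nerve Q c)"
      using \<open>u \<in> topspace (hocolim Q G g)\<close> by (rule hocolim_cases)
    have cpt': "(c, p, t) \<in> topspace (hocolim_sum Q G)"
      using cpt by simp
    moreover    have "(l c, \<zeta> c p, nerve_map Q P l t) \<in> topspace (hocolim_sum P F)"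
      using cpt lc by (auto intro: l.component_closed l.nerve_map_closed)
    ultimately have "?S (?L u) =
        hocolim_point Q G g (s (l c), \<theta> (l c) (\<zeta> c p), nerve_map P Q s (nerve_map Q P l t))"
      by (simp only: u s.hocolim_map_point l.hocolim_map_point)
    moreover have "\<theta> (l c) (\<zeta> c p) = g c ((s \<circ> l) c) p"
      using cpt lc unit by (simp add: \<zeta>_def \<theta>\<psi> s.Q.structure_map_closed)
    moreover have "nerve_map P Q s (nerve_map Q P l t) = nerve_map Q Q (s \<circ> l) t"
      using s.P.finite_carrier s.Q.finite_carrier l by (simp add: nerve_map_compose)
    moreover have "hocolim_map Q Q G g (s \<circ> l) (\<lambda>c. g c ((s \<circ> l) c)) u =
        hocolim_point Q G g ((s \<circ> l) c, g c ((s \<circ> l) c) p, nerve_map Q Q (s \<circ> l) t)"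
      unfolding u by (rule diagram_map.hocolim_map_point[OF sl.diagram_map_inflationary cpt'])
    ultimately show ?thesis
      by (simp only: o_apply)
  qed
  then have "homotopic_with (\<lambda>_. True) (hocolim Q G g) (hocolim Q G g) (?S \<circ> ?L)
      (hocolim_map Q Q G g (s \<circ> l) (\<lambda>c. g c ((s \<circ> l) c)))"
    using continuous_map_compose[OF l.continuous_map_hocolim_map s.continuous_map_hocolim_map]
    by (intro homotopic_with_equal TrueI)
  then have 2: "homotopic_with (\<lambda>_. True) (hocolim Q G g) (hocolim Q G g) (?S \<circ> ?L) id"
    using sl.homotopic_hocolim_map_inflationary
    by (rule homotopic_with_trans[OF _ homotopic_with_symD])
  show ?thesis
    unfolding homotopy_equivalence_def
    by (intro conjI exI[of _ ?L] s.continuous_map_hocolim_map l.continuous_map_hocolim_map 1 2)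
qed

section \<open>The simplicial transform in coordinates\<close>

lemma (in partial_order) finite_ex_minimal:
  assumes "finite (carrier L)" "A \<subseteq> carrier L" "A \<noteq> {}"
  shows "\<exists>m\<in>A. \<forall>w\<in>A. w \<sqsubseteq> m \<longrightarrow> w = m"
proof -
  \<comment> \<open>An element of \<open>A\<close> with the fewest elements below it is minimal.\<close>
  let ?card = "\<lambda>z. card {w \<in> carrier L. w \<sqsubseteq> z}"
  obtain m where m: "m \<in> A" "\<And>w. w \<in> A \<Longrightarrow> ?card m \<le> ?card w"
    using ex_has_least_nat[of "\<lambda>z. z \<in> A" _ ?card] assms(3) by blast
  have "w = m" if w: "w \<in> A" "w \<sqsubseteq> m" for w
  proof -
    have wm: "w \<in> carrier L" "m \<in> carrier L"
      using w(1) m(1) assms(2) by auto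
    have "{v \<in> carrier L. v \<sqsubseteq> w} = {v \<in> carrier L. v \<sqsubseteq> m}"
    proof (rule card_seteq)
      show "{v \<in> carrier L. v \<sqsubseteq> w} \<subseteq> {v \<in> carrier L. v \<sqsubseteq> m}"
        using w(2) wm le_trans by blast
    qed (use assms(1) m(2)[OF w(1)] in auto)
    then have "m \<sqsubseteq> w"
      using wm le_refl by blast
    then show ?thesis
      using w(2) wm le_antisym by blast
  qed
  then show ?thesis
    using m(1) by blast
qed

locale polyhedral_poset = partial_order P
  for P :: "'p gorder" (structure) +
  assumes polyhedral: "polyhedral P"
begin

lemma finite_carrier: "finite (carrier P)"
  using polyhedral by (simp add: polyhedral_def)

lemma least_bottom: "least P \<bottom> (carrier P)"
  using polyhedral unfolding polyhedral_def pointed_def bottom_def by (metis someI_ex)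

lemma bottom_closed: "\<bottom> \<in> carrier P"
  using least_bottom by (simp add: least_def)

lemma bottom_le: "x \<in> carrier P \<Longrightarrow> \<bottom> \<sqsubseteq> x"
  using least_bottom by (auto simp: least_def)

lemma ex_greatest_lower_bound:
  assumes "x \<in> carrier P" "y \<in> carrier P" "z \<in> carrier P" "x \<sqsubseteq> z" "y \<sqsubseteq> z"
  obtains m where "m \<in> carrier P" "m \<sqsubseteq> x" "m \<sqsubseteq> y"
    "\<And>w. \<lbrakk>w \<in> carrier P; w \<sqsubseteq> x; w \<sqsubseteq> y\<rbrakk> \<Longrightarrow> w \<sqsubseteq> m"
proof -
  let ?B = "below P z"
  have "lower_semilattice ?B"
    using polyhedral assms(3) by (simp add: polyhedral_def)
  moreover have "x \<in> carrier ?B" "y \<in> carrier ?B"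
    using assms by (auto simp: below_def)
  ultimately obtain m where m: "greatest ?B m (Lower ?B {x, y})"
    using lower_semilattice.inf_of_two_exists by metis
  have c: "carrier ?B = {w \<in> carrier P. w \<sqsubseteq> z}" and le: "(\<sqsubseteq>\<^bsub>?B\<^esub>) = (\<sqsubseteq>)"
    by (simp_all add: below_def)
  have "Lower ?B {x, y} = {w \<in> carrier P. w \<sqsubseteq> x \<and> w \<sqsubseteq> y}"
    using assms le_trans[OF _ assms(4)] by (auto simp: Lower_def c le)
  then show thesis
    using m by (intro that[of m]) (auto simp: greatest_def le)
qed

lemma vertices_of_iff: "v \<in> vertices_of P x \<longleftrightarrow> v \<in> vertices P \<and> v \<sqsubseteq> x"
  by (simp add: vertices_of_def)

lemma vertices_closed: "v \<in> vertices P \<Longrightarrow> v \<in> carrier P"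
  by (simp add: vertices_def)

lemma vertices_of_mono:
  assumes "x \<in> carrier P" "y \<in> carrier P" "x \<sqsubseteq> y"
  shows "vertices_of P x \<subseteq> vertices_of P y"
  using assms(1,2) le_trans[OF _ assms(3)] by (auto simp: vertices_of_iff vertices_closed)

text \<open>
  Meets trade upper bounds for lower bounds: the meet of \<open>x\<close> and \<open>y\<close> below \<open>z\<close> is above every vertex in
  \<open>S\<close>, as such a vertex is a lower bound of \<open>x\<close> and \<open>y\<close>.
\<close>

lemma ex_meet_vertices:
  assumes "x \<in> carrier P" "y \<in> carrier P" "z \<in> carrier P" "x \<sqsubseteq> z" "y \<sqsubseteq> z"
    and "S \<subseteq> vertices_of P x" "S \<subseteq> vertices_of P y"
  obtains m where "m \<in> carrier P" "m \<sqsubseteq> x" "m \<sqsubseteq> y" "S \<subseteq> vertices_of P m"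
proof -
  obtain m where m: "m \<in> carrier P" "m \<sqsubseteq> x" "m \<sqsubseteq> y"
    "\<And>w. \<lbrakk>w \<in> carrier P; w \<sqsubseteq> x; w \<sqsubseteq> y\<rbrakk> \<Longrightarrow> w \<sqsubseteq> m"
    using ex_greatest_lower_bound[OF assms(1-5)] by blast
  have "S \<subseteq> vertices_of P m"
  proof
    fix v assume "v \<in> S"
    then have "v \<in> vertices P" "v \<sqsubseteq> x" "v \<sqsubseteq> y"
      using assms(6,7) by (auto simp: vertices_of_iff)
    then show "v \<in> vertices_of P m"
      using m(4) vertices_closed by (simp add: vertices_of_iff)
  qed
  with m show thesis
    by (intro that)
qed

lemma minimal_upper_bounds_nonempty_iff:
  assumes "x \<in> carrier P" "y \<in> carrier P"
  shows "minimal_upper_bounds P x y \<noteq> {} \<longleftrightarrow> (\<exists>z\<in>carrier P. x \<sqsubseteq> z \<and> y \<sqsubseteq> z)"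
proof -
  have U: "Upper P {x, y} = {z \<in> carrier P. x \<sqsubseteq> z \<and> y \<sqsubseteq> z}"
    using assms by (auto simp: Upper_def)
  have "\<exists>m\<in>Upper P {x, y}. \<forall>w\<in>Upper P {x, y}. w \<sqsubseteq> m \<longrightarrow> w = m" if "Upper P {x, y} \<noteq> {}"
    using that by (intro finite_ex_minimal finite_carrier) auto
  then have "minimal_upper_bounds P x y \<noteq> {} \<longleftrightarrow> Upper P {x, y} \<noteq> {}"
    unfolding minimal_upper_bounds_def by auto
  then show ?thesis
    by (auto simp: U)
qed

text \<open>
  One common lower bound replaces the whole zigzag of upper bounds: two successive steps through \<open>w\<close>
  give two lower bounds below \<open>w\<close>, and these have a meet.
\<close>

lemma st_rel_iff:
  "((x, S), (y, T)) \<in> st_rel P \<longleftrightarrow>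
     S = T \<and> x \<in> carrier P \<and> y \<in> carrier P \<and>
     (\<exists>m\<in>carrier P. m \<sqsubseteq> x \<and> m \<sqsubseteq> y \<and> S \<subseteq> vertices_of P m)"
  (is "_ \<longleftrightarrow> ?rhs x S y T")
proof
  let ?R = "{((x, S), (y, T)). (x, S) \<in> st_pairs P \<and> (y, T) \<in> st_pairs P \<and>
      S = T \<and> minimal_upper_bounds P x y \<noteq> {}}"
  have step: "?rhs x S y T" if "((x, S), (y, T)) \<in> ?R" for x S y T
  proof -
    have xy: "x \<in> carrier P" "y \<in> carrier P" "S \<subseteq> vertices_of P x" "S \<subseteq> vertices_of P y" "S = T"
      using that by (auto simp: st_pairs_def)
    have "minimal_upper_bounds P x y \<noteq> {}"
      using that by simp
    then obtain z where "z \<in> carrier P" "x \<sqsubseteq> z" "y \<sqsubseteq> z"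
      using minimal_upper_bounds_nonempty_iff[OF xy(1,2)] by blast
    with xy show ?thesis
      using ex_meet_vertices[of x y z S] by metis
  qed
  {
    assume "((x, S), (y, T)) \<in> st_rel P"
    then have "((x, S), (y, T)) \<in> ?R\<^sup>+"
      by (simp only: st_rel_def)
    then show "?rhs x S y T"
    proof (induction "(y, T)" arbitrary: y T rule: trancl_induct)
      case (base y T)
      then show ?case by (rule step)
    next
      case (step b y T)
      obtain w U where b: "b = (w, U)"
        by (cases b)
      have "?rhs w U y T"
        using step(2) unfolding b by (rule \<open>\<And>x S y T. ((x, S), (y, T)) \<in> ?R \<Longrightarrow> ?rhs x S y T\<close>)
      then obtain n where n: "U = T" "w \<in> carrier P" "y \<in> carrier P"
        "n \<in> carrier P" "n \<sqsubseteq> w" "n \<sqsubseteq> y" "U \<subseteq> vertices_of P n"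
        by blast
      obtain m where m: "S = U" "x \<in> carrier P" "m \<in> carrier P" "m \<sqsubseteq> x" "m \<sqsubseteq> w"
        "S \<subseteq> vertices_of P m"
        using step(3)[OF b] by blast
      obtain k where "k \<in> carrier P" "k \<sqsubseteq> m" "k \<sqsubseteq> n" "S \<subseteq> vertices_of P k"
        using ex_meet_vertices[of m n w S] m n by metis
      then show ?case
        using m n le_trans[of k m x] le_trans[of k n y] by blast
    qed
  }
  assume "?rhs x S y T"
  then obtain m where m: "S = T" "x \<in> carrier P" "y \<in> carrier P" "m \<in> carrier P" "m \<sqsubseteq> x" "m \<sqsubseteq> y"
    "S \<subseteq> vertices_of P m"
    by blast
  have "((z, S), (m, S)) \<in> ?R \<and> ((m, S), (z, S)) \<in> ?R" if "z \<in> carrier P" "m \<sqsubseteq> z" for z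
    using that m(4,7) vertices_of_mono[OF m(4) that]
      minimal_upper_bounds_nonempty_iff[OF that(1) m(4)]
      minimal_upper_bounds_nonempty_iff[OF m(4) that(1)]
    by (auto simp: st_pairs_def)
  then have "((x, S), (m, S)) \<in> ?R" "((m, S), (y, S)) \<in> ?R"
    using m by blast+
  then show "((x, S), (y, T)) \<in> st_rel P"
    unfolding st_rel_def m(1) by (meson trancl.simps)
qed

lemma st_rel_refl: "(x, S) \<in> st_pairs P \<Longrightarrow> ((x, S), (x, S)) \<in> st_rel P"
  by (auto simp: st_rel_iff st_pairs_def)

lemma st_rel_sym: "((x, S), (y, T)) \<in> st_rel P \<Longrightarrow> ((y, T), (x, S)) \<in> st_rel P"
  by (auto simp: st_rel_iff)

lemma st_rel_trans:
  "\<lbrakk>((x, S), (y, T)) \<in> st_rel P; ((y, T), (z, U)) \<in> st_rel P\<rbrakk> \<Longrightarrow> ((x, S), (z, U)) \<in> st_rel P"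
  unfolding st_rel_def by (rule trancl_trans)

text \<open>
  A class is downward directed by \<open>st_rel_iff\<close>, hence has a least element, and it is closed upwards
  because \<open>b\<close> itself is a common lower bound of \<open>b\<close> and anything above it.
\<close>

lemma st_class_principal:
  assumes "(x, S) \<in> st_pairs P"
  obtains b where "b \<in> carrier P" "S \<subseteq> vertices_of P b" "b \<sqsubseteq> x"
    "st_class P x S = {y \<in> carrier P. b \<sqsubseteq> y} \<times> {S}"
proof -
  define A where "A = {y \<in> carrier P. ((x, S), (y, S)) \<in> st_rel P}"
  have x: "x \<in> A" "A \<subseteq> carrier P"
    using assms st_rel_refl[OF assms] by (auto simp: A_def st_pairs_def)
  then obtain b where b: "b \<in> A" "\<forall>w\<in>A. w \<sqsubseteq> b \<longrightarrow> w = b"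
    using finite_ex_minimal[OF finite_carrier, of A] by blast
  have lower: "\<exists>m\<in>A. m \<sqsubseteq> y \<and> m \<sqsubseteq> z" if "y \<in> A" "z \<in> A" for y z
  proof -
    have "((y, S), (z, S)) \<in> st_rel P"
      using that st_rel_trans[OF st_rel_sym[of x S y S], of z S] by (simp add: A_def)
    then obtain m where m: "m \<in> carrier P" "m \<sqsubseteq> y" "m \<sqsubseteq> z" "S \<subseteq> vertices_of P m"
      unfolding st_rel_iff by blast
    then have "((y, S), (m, S)) \<in> st_rel P"
      using that(1) le_refl[OF m(1)] x(2) unfolding st_rel_iff by blast
    then have "m \<in> A"
      using that(1) m(1) st_rel_trans[of x S y S] by (simp add: A_def)
    then show ?thesis
      using m(2,3) by blast
  qed
  have b_le: "b \<sqsubseteq> y" if "y \<in> A" for y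
    using lower[OF b(1) that] b(2) by blast
  have bc: "b \<in> carrier P" "S \<subseteq> vertices_of P b"
  proof -
    show "b \<in> carrier P"
      using b(1) x(2) by blast
    obtain m where "m \<in> carrier P" "m \<sqsubseteq> b" "S \<subseteq> vertices_of P m"
      using b(1) unfolding A_def st_rel_iff by blast
    then show "S \<subseteq> vertices_of P b"
      using vertices_of_mono[of m b] \<open>b \<in> carrier P\<close> by blast
  qed
  have "y \<in> A" if "y \<in> carrier P" "b \<sqsubseteq> y" for y
  proof -
    have "((b, S), (y, S)) \<in> st_rel P"
      using bc that le_refl[OF bc(1)] unfolding st_rel_iff by blast
    then show ?thesis
      using b(1) that(1) st_rel_trans[of x S b S] by (simp add: A_def)
  qed
  then have A: "A = {y \<in> carrier P. b \<sqsubseteq> y}"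
    using b_le x(2) by blast
  have "st_class P x S = A \<times> {S}"
    by (auto simp: st_class_def A_def st_rel_iff)
  with A show thesis
    using that[OF bc b_le[OF x(1)]] by simp
qed

text \<open>
  The coordinates of an element of the simplicial transform. The base is the left adjoint of
  \<open>st_map\<close>; the union defining the support is over copies of one set.
\<close>

definition st_base :: "('p \<times> 'p set) set \<Rightarrow> 'p" where
  "st_base c = (THE b. b \<in> fst ` c \<and> (\<forall>y\<in>fst ` c. b \<sqsubseteq> y))"

definition st_support :: "('p \<times> 'p set) set \<Rightarrow> 'p set" where
  "st_support c = \<Union> (snd ` c)"

lemma st_base_support_principal:
  assumes "b \<in> carrier P"
  shows "st_base ({y \<in> carrier P. b \<sqsubseteq> y} \<times> {S}) = b"
    and "st_support ({y \<in> carrier P. b \<sqsubseteq> y} \<times> {S}) = S"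
proof -
  have fst: "fst ` ({y \<in> carrier P. b \<sqsubseteq> y} \<times> {S}) = {y \<in> carrier P. b \<sqsubseteq> y}"
    by force
  show "st_base ({y \<in> carrier P. b \<sqsubseteq> y} \<times> {S}) = b"
    unfolding st_base_def fst using assms by (intro the_equality) (auto intro: le_antisym)
  show "st_support ({y \<in> carrier P. b \<sqsubseteq> y} \<times> {S}) = S"
    unfolding st_support_def using assms by force
qed

lemma carrier_simplicial_transform:
  "carrier (simplicial_transform P) = {st_class P x S | x S. (x, S) \<in> st_pairs P}"
  by (auto simp: simplicial_transform_def quotient_def st_class_def)

lemma simplicial_transform_normal_form:
  assumes "c \<in> carrier (simplicial_transform P)"
  shows "st_base c \<in> carrier P" "st_support c \<subseteq> vertices_of P (st_base c)"
    "c = {y \<in> carrier P. st_base c \<sqsubseteq> y} \<times> {st_support c}"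
proof -
  obtain x S where x: "(x, S) \<in> st_pairs P" "c = st_class P x S"
    using assms by (auto simp: carrier_simplicial_transform)
  obtain b where b: "b \<in> carrier P" "S \<subseteq> vertices_of P b" "b \<sqsubseteq> x"
    "st_class P x S = {y \<in> carrier P. b \<sqsubseteq> y} \<times> {S}"
    by (rule st_class_principal[OF x(1)])
  have eq: "st_base c = b" "st_support c = S"
    by (simp_all only: x(2) b(4) st_base_support_principal[OF b(1)])
  show "st_base c \<in> carrier P" "st_support c \<subseteq> vertices_of P (st_base c)"
    using b(1,2) by (simp_all only: eq)
  show "c = {y \<in> carrier P. st_base c \<sqsubseteq> y} \<times> {st_support c}"
    by (simp only: eq) (simp only: x(2) b(4))
qed

lemma simplicial_transform_eqI:
  assumes "c \<in> carrier (simplicial_transform P)" "d \<in> carrier (simplicial_transform P)"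
    and "st_base c = st_base d" "st_support c = st_support d"
  shows "c = d"
  by (subst simplicial_transform_normal_form(3)[OF assms(1)],
      subst simplicial_transform_normal_form(3)[OF assms(2)]) (simp only: assms(3,4))

lemma st_class_closed: "(x, S) \<in> st_pairs P \<Longrightarrow> st_class P x S \<in> carrier (simplicial_transform P)"
  by (auto simp: carrier_simplicial_transform)

lemma st_class_base_support:
  assumes "(x, S) \<in> st_pairs P"
  shows "st_base (st_class P x S) \<sqsubseteq> x" "st_support (st_class P x S) = S"
proof -
  obtain b where b: "b \<in> carrier P" "S \<subseteq> vertices_of P b" "b \<sqsubseteq> x"
    "st_class P x S = {y \<in> carrier P. b \<sqsubseteq> y} \<times> {S}"
    by (rule st_class_principal[OF assms])
  show "st_base (st_class P x S) \<sqsubseteq> x" "st_support (st_class P x S) = S"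
    using b st_base_support_principal[OF b(1), of S] by simp_all
qed

text \<open>
  If representatives of \<open>c\<close> and \<open>d\<close> have an upper bound \<open>z\<close>, then so do the bases \<open>a\<close> and \<open>b\<close>. A lower bound \<open>m\<close>
  of \<open>a\<close> and \<open>b\<close> that is above the support of \<open>c\<close> represents \<open>c\<close> again, hence \<open>a \<sqsubseteq> m \<sqsubseteq> b\<close>.
\<close>

lemma simplicial_transform_le_iff:
  assumes c: "c \<in> carrier (simplicial_transform P)" and d: "d \<in> carrier (simplicial_transform P)"
  shows "c \<sqsubseteq>\<^bsub>simplicial_transform P\<^esub> d \<longleftrightarrow>
     st_base c \<sqsubseteq> st_base d \<and> st_support c \<subseteq> st_support d"
proof -
  define a S where "a = st_base c" and "S = st_support c"
  define b T where "b = st_base d" and "T = st_support d"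
  have a: "a \<in> carrier P" "S \<subseteq> vertices_of P a" and c_eq: "c = {y \<in> carrier P. a \<sqsubseteq> y} \<times> {S}"
    using simplicial_transform_normal_form[OF c] by (simp_all add: a_def S_def)
  have b: "b \<in> carrier P" "T \<subseteq> vertices_of P b" and d_eq: "d = {y \<in> carrier P. b \<sqsubseteq> y} \<times> {T}"
    using simplicial_transform_normal_form[OF d] by (simp_all add: b_def T_def)
  have c_rel: "(m, S) \<in> c" if "m \<in> carrier P" "m \<sqsubseteq> a" "S \<subseteq> vertices_of P m" for m
  proof -
    obtain x U where xU: "(x, U) \<in> st_pairs P" "c = st_class P x U"
      using c by (auto simp: carrier_simplicial_transform)
    have "(a, S) \<in> c"
      using a by (simp add: c_eq)
    then have "((x, U), (a, S)) \<in> st_rel P"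
      by (simp add: xU(2) st_class_def)
    moreover have "((a, S), (m, S)) \<in> st_rel P"
      using that a(1) le_refl unfolding st_rel_iff by blast
    ultimately show ?thesis
      unfolding xU(2) st_class_def using st_rel_trans by blast
  qed
  have "c \<sqsubseteq>\<^bsub>simplicial_transform P\<^esub> d \<longleftrightarrow>
      (\<exists>(x, S)\<in>c. \<exists>(y, T)\<in>d. S \<subseteq> T \<and> minimal_upper_bounds P x y \<noteq> {})"
    by (simp add: simplicial_transform_def)
  also have "\<dots> \<longleftrightarrow> (\<exists>x y. x \<in> carrier P \<and> a \<sqsubseteq> x \<and> y \<in> carrier P \<and> b \<sqsubseteq> y \<and> S \<subseteq> T \<and>
      minimal_upper_bounds P x y \<noteq> {})"
    unfolding c_eq d_eq by auto
  finally have le: "c \<sqsubseteq>\<^bsub>simplicial_transform P\<^esub> d \<longleftrightarrow>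
      (\<exists>x y. x \<in> carrier P \<and> a \<sqsubseteq> x \<and> y \<in> carrier P \<and> b \<sqsubseteq> y \<and> S \<subseteq> T \<and>
        minimal_upper_bounds P x y \<noteq> {})" .
  have "c \<sqsubseteq>\<^bsub>simplicial_transform P\<^esub> d \<longleftrightarrow> a \<sqsubseteq> b \<and> S \<subseteq> T"
  proof
    assume "c \<sqsubseteq>\<^bsub>simplicial_transform P\<^esub> d"
    then obtain x y where xy: "x \<in> carrier P" "a \<sqsubseteq> x" "y \<in> carrier P" "b \<sqsubseteq> y" "S \<subseteq> T"
      "minimal_upper_bounds P x y \<noteq> {}"
      unfolding le by blast
    then obtain z where z: "z \<in> carrier P" "x \<sqsubseteq> z" "y \<sqsubseteq> z"
      using minimal_upper_bounds_nonempty_iff[of x y] by blast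
    have "a \<sqsubseteq> z" "b \<sqsubseteq> z"
      using le_trans[of a x z] le_trans[of b y z] xy z a(1) b(1) by blast+
    then obtain m where m: "m \<in> carrier P" "m \<sqsubseteq> a" "m \<sqsubseteq> b" "S \<subseteq> vertices_of P m"
      using ex_meet_vertices[of a b z S] a b z(1) xy(5) by (metis subset_trans)
    then have "a \<sqsubseteq> m"
      using c_rel[of m] by (simp add: c_eq)
    then show "a \<sqsubseteq> b \<and> S \<subseteq> T"
      using le_trans[of a m b] m a(1) b(1) xy(5) by blast
  next
    assume ab: "a \<sqsubseteq> b \<and> S \<subseteq> T"
    then have "minimal_upper_bounds P a b \<noteq> {}"
      using minimal_upper_bounds_nonempty_iff[OF a(1) b(1)] b(1) le_refl by blast
    then show "c \<sqsubseteq>\<^bsub>simplicial_transform P\<^esub> d"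
      unfolding le using ab a(1) b(1) le_refl by blast
  qed
  then show ?thesis
    by (simp add: a_def b_def S_def T_def)
qed

lemma partial_order_simplicial_transform: "partial_order (simplicial_transform P)"
proof -
  have eq: "(.=\<^bsub>simplicial_transform P\<^esub>) = (=)"
    by (simp add: simplicial_transform_def)
  show ?thesis
  proof (unfold_locales, unfold eq)
    fix c d e
    assume c: "c \<in> carrier (simplicial_transform P)"
    show "c \<sqsubseteq>\<^bsub>simplicial_transform P\<^esub> c"
      using c simplicial_transform_normal_form(1) by (simp add: simplicial_transform_le_iff)
    assume d: "d \<in> carrier (simplicial_transform P)"
    show "c = d" if "c \<sqsubseteq>\<^bsub>simplicial_transform P\<^esub> d" "d \<sqsubseteq>\<^bsub>simplicial_transform P\<^esub> c"
      using that c d simplicial_transform_normal_form(1) le_antisym[of "st_base c" "st_base d"]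
      by (intro simplicial_transform_eqI) (auto simp: simplicial_transform_le_iff)
    assume e: "e \<in> carrier (simplicial_transform P)"
    show "c \<sqsubseteq>\<^bsub>simplicial_transform P\<^esub> e"
      if "c \<sqsubseteq>\<^bsub>simplicial_transform P\<^esub> d" "d \<sqsubseteq>\<^bsub>simplicial_transform P\<^esub> e"
      using that c d e simplicial_transform_normal_form(1)
        le_trans[of "st_base c" "st_base d" "st_base e"]
      by (auto simp: simplicial_transform_le_iff)
  qed auto
qed

lemma finite_simplicial_transform: "finite (carrier (simplicial_transform P))"
proof -
  have "st_pairs P \<subseteq> carrier P \<times> Pow (carrier P)"
    using vertices_closed by (auto simp: st_pairs_def vertices_of_def)
  then have "finite (st_pairs P)"
    using finite_carrier by (auto intro: finite_subset)
  moreover have "carrier (simplicial_transform P) = (\<lambda>(x, S). st_class P x S) ` st_pairs P"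
    by (auto simp: carrier_simplicial_transform)
  ultimately show ?thesis
    by simp
qed

text \<open>An element with empty support is also represented by \<open>(\<bottom>, {})\<close>, so it is the least one.\<close>

lemma bottom_simplicial_transform:
  shows "st_class P \<bottom> {} \<in> carrier (simplicial_transform P)"
    and "\<bottom>\<^bsub>simplicial_transform P\<^esub> = st_class P \<bottom> {}"
    and "c \<in> carrier (simplicial_transform P) \<Longrightarrow>
      c = \<bottom>\<^bsub>simplicial_transform P\<^esub> \<longleftrightarrow> st_support c = {}"
proof -
  interpret s: partial_order "simplicial_transform P"
    by (rule partial_order_simplicial_transform)
  let ?b = "st_class P \<bottom> {}"
  have pair: "(\<bottom>, {}) \<in> st_pairs P"
    by (simp add: st_pairs_def bottom_closed)
  show b: "?b \<in> carrier (simplicial_transform P)"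
    by (rule st_class_closed[OF pair])
  have base: "st_base ?b = \<bottom>" "st_support ?b = {}"
    using st_class_base_support[OF pair] simplicial_transform_normal_form(1)[OF b]
      le_antisym bottom_le bottom_closed by blast+
  have least: "?b \<sqsubseteq>\<^bsub>simplicial_transform P\<^esub> c" if "c \<in> carrier (simplicial_transform P)" for c
    using that b base simplicial_transform_normal_form(1) bottom_le
    by (simp add: simplicial_transform_le_iff)
  then have "least (simplicial_transform P) ?b (carrier (simplicial_transform P))"
    using b by (auto simp: least_def)
  then show bot: "\<bottom>\<^bsub>simplicial_transform P\<^esub> = ?b"
    unfolding bottom_def using s.least_unique by (intro some_equality) 
  show "c = \<bottom>\<^bsub>simplicial_transform P\<^esub> \<longleftrightarrow> st_support c = {}"
    if c: "c \<in> carrier (simplicial_transform P)"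
  proof
    assume supp: "st_support c = {}"
    have nf: "st_base c \<in> carrier P" "c = {y \<in> carrier P. st_base c \<sqsubseteq> y} \<times> {{}}"
      using simplicial_transform_normal_form[OF c] supp by auto
    obtain x where x: "(x, {}) \<in> st_pairs P" "c = st_class P x {}"
      using c supp st_class_base_support(2) by (auto simp: carrier_simplicial_transform)
    have "((x, {}), (\<bottom>, {})) \<in> st_rel P"
      using x(1) bottom_closed bottom_le unfolding st_rel_iff st_pairs_def by auto
    then have "(\<bottom>, {}) \<in> c"
      by (simp add: x(2) st_class_def)
    then have "st_base c \<sqsubseteq> \<bottom>"
      using nf(2) by blast
    then have "st_base c = \<bottom>"
      using nf(1) bottom_le bottom_closed le_antisym by blast
    then show "c = \<bottom>\<^bsub>simplicial_transform P\<^esub>"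
      unfolding bot using c b base supp by (intro simplicial_transform_eqI) auto
  qed (simp add: bot base)
qed

lemma st_vertex_simps:
  assumes "v \<in> vertices P"
  shows "st_vertex P v \<in> carrier (simplicial_transform P)"
    and "st_base (st_vertex P v) = v" and "st_support (st_vertex P v) = {v}"
proof -
  have v: "v \<in> carrier P" "(v, {v}) \<in> st_pairs P"
    using assms vertices_closed by (auto simp: st_pairs_def vertices_of_iff)
  show c: "st_vertex P v \<in> carrier (simplicial_transform P)"
    unfolding st_vertex_def by (rule st_class_closed[OF v(2)])
  show s: "st_support (st_vertex P v) = {v}"
    unfolding st_vertex_def by (rule st_class_base_support(2)[OF v(2)])
  have "v \<sqsubseteq> st_base (st_vertex P v)"
    using simplicial_transform_normal_form(2)[OF c] s by (simp add: vertices_of_iff)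
  then show "st_base (st_vertex P v) = v"
    using st_class_base_support(1)[OF v(2)] simplicial_transform_normal_form(1)[OF c] v(1) le_antisym
    unfolding st_vertex_def by blast
qed

lemma st_vertex_le_iff:
  assumes "v \<in> vertices P" "c \<in> carrier (simplicial_transform P)"
  shows "st_vertex P v \<sqsubseteq>\<^bsub>simplicial_transform P\<^esub> c \<longleftrightarrow> v \<in> st_support c"
  using assms simplicial_transform_normal_form(2)[OF assms(2)] st_vertex_simps
  by (auto simp: simplicial_transform_le_iff vertices_of_iff)

text \<open>
  Below an element with a nonempty support lies \<open>[v, {v}]\<close> for each \<open>v\<close> in the support, so a vertex must
  be of this form.
\<close>

lemma vertices_simplicial_transform:
  "vertices (simplicial_transform P) = st_vertex P ` vertices P"
proof
  interpret s: partial_order "simplicial_transform P"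
    by (rule partial_order_simplicial_transform)
  have less: "c \<sqsubset>\<^bsub>simplicial_transform P\<^esub> d \<longleftrightarrow> c \<sqsubseteq>\<^bsub>simplicial_transform P\<^esub> d \<and> c \<noteq> d" for c d
    by (simp add: lless_def s.eq_is_equal)
  show "vertices (simplicial_transform P) \<subseteq> st_vertex P ` vertices P"
  proof
    fix c assume "c \<in> vertices (simplicial_transform P)"
    then have c: "c \<in> carrier (simplicial_transform P)" "c \<noteq> \<bottom>\<^bsub>simplicial_transform P\<^esub>"
      and min: "\<And>d. \<lbrakk>d \<in> carrier (simplicial_transform P); d \<sqsubseteq>\<^bsub>simplicial_transform P\<^esub> c; d \<noteq> c\<rbrakk>
        \<Longrightarrow> d = \<bottom>\<^bsub>simplicial_transform P\<^esub>"
      unfolding vertices_def less by blast+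
    obtain v where v: "v \<in> st_support c"
      using c bottom_simplicial_transform(3) by auto
    then have vP: "v \<in> vertices P"
      using simplicial_transform_normal_form(2)[OF c(1)] by (auto simp: vertices_of_iff)
    have "st_vertex P v \<noteq> \<bottom>\<^bsub>simplicial_transform P\<^esub>"
      using bottom_simplicial_transform(3) st_vertex_simps[OF vP] by auto
    then have "st_vertex P v = c"
      using min[of "st_vertex P v"] st_vertex_simps(1)[OF vP] st_vertex_le_iff[OF vP c(1)] v by blast
    then show "c \<in> st_vertex P ` vertices P"
      using vP by blast
  qed
  show "st_vertex P ` vertices P \<subseteq> vertices (simplicial_transform P)"
  proof
    fix c assume "c \<in> st_vertex P ` vertices P"
    then obtain v where v: "v \<in> vertices P" and c: "c = st_vertex P v"
      by blast
    have cP: "c \<in> carrier (simplicial_transform P)"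
      unfolding c by (rule st_vertex_simps(1)[OF v])
    have "d = \<bottom>\<^bsub>simplicial_transform P\<^esub>"
      if d: "d \<in> carrier (simplicial_transform P)" "d \<sqsubseteq>\<^bsub>simplicial_transform P\<^esub> c" "d \<noteq> c" for d
    proof (rule ccontr)
      assume "d \<noteq> \<bottom>\<^bsub>simplicial_transform P\<^esub>"
      then have "st_support d = {v}"
        using d(1,2) cP st_vertex_simps[OF v] bottom_simplicial_transform(3)[OF d(1)]
        by (auto simp: simplicial_transform_le_iff c)
      then have "c \<sqsubseteq>\<^bsub>simplicial_transform P\<^esub> d"
        using st_vertex_le_iff[OF v d(1)] by (simp add: c)
      then show False
        using d cP s.le_antisym by blast
    qed
    then show "c \<in> vertices (simplicial_transform P)"
      using cP bottom_simplicial_transform(3)[OF cP] st_vertex_simps(3)[OF v]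
      unfolding vertices_def less by (auto simp: c)
  qed
qed

lemma inj_on_st_vertex: "inj_on (st_vertex P) (vertices P)"
  by (metis inj_onI singleton_inject st_vertex_simps(3))

lemma st_label_st_vertex: "v \<in> vertices P \<Longrightarrow> st_label P (st_vertex P v) = v"
  unfolding st_label_def by (rule inv_into_f_f[OF inj_on_st_vertex])

lemma st_vertex_mem_vertices_of_iff:
  assumes "v \<in> vertices P" "c \<in> carrier (simplicial_transform P)"
  shows "st_vertex P v \<in> vertices_of (simplicial_transform P) c \<longleftrightarrow> v \<in> st_support c"
  using assms st_vertex_le_iff[OF assms]
  by (auto simp: vertices_of_def vertices_simplicial_transform)

lemma st_map_closed: "x \<in> carrier P \<Longrightarrow> st_map P x \<in> carrier (simplicial_transform P)"
  unfolding st_map_def by (rule st_class_closed) (simp add: st_pairs_def)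

lemma st_support_st_map: "x \<in> carrier P \<Longrightarrow> st_support (st_map P x) = vertices_of P x"
  unfolding st_map_def by (rule st_class_base_support(2)) (simp add: st_pairs_def)

lemma st_base_st_map_le: "x \<in> carrier P \<Longrightarrow> st_base (st_map P x) \<sqsubseteq> x"
  unfolding st_map_def by (rule st_class_base_support(1)) (simp add: st_pairs_def)

text \<open>The base of \<open>st_map P x\<close> lies below \<open>x\<close> and has the same vertices, so reducedness applies.\<close>

lemma st_base_st_map:
  assumes "reduced_poset P" "x \<in> carrier P"
  shows "st_base (st_map P x) = x"
proof -
  let ?b = "st_base (st_map P x)"
  note c = st_map_closed[OF assms(2)]
  have b: "?b \<in> carrier P" "?b \<sqsubseteq> x"
    using simplicial_transform_normal_form(1)[OF c] st_base_st_map_le[OF assms(2)] by auto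
  have "vertices_of P ?b = vertices_of P x"
    using simplicial_transform_normal_form(2)[OF c] vertices_of_mono[OF b(1) assms(2) b(2)]
    by (simp add: st_support_st_map[OF assms(2)])
  then show ?thesis
    using assms b by (auto simp: reduced_poset_def)
qed

end

section \<open>Polyhedral products\<close>

lemma top_diagram_polyhedral_functor:
  assumes "partial_order P" "finite (carrier P)"
  shows "top_diagram P (polyhedral_functor P X A) polyhedral_inclusion"
proof -
  interpret partial_order P
    by (rule assms)
  show ?thesis
  proof
    show "finite (carrier P)"
      by (rule assms)
    fix x y assume xy: "x \<in> carrier P" "y \<in> carrier P" "x \<sqsubseteq>\<^bsub>P\<^esub> y"
    let ?Y = "\<lambda>x v. if v \<in> vertices_of P x then X v else subtopology (X v) (A v)"
    have "continuous_map (product_topology (?Y x) (vertices P)) (?Y y v) (\<lambda>p. p v)"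
      if "v \<in> vertices P" for v
    proof -
      have "v \<in> vertices_of P x \<Longrightarrow> v \<in> vertices_of P y"
        using xy(1,2) le_trans[OF _ xy(3)] by (auto simp: vertices_of_def vertices_def)
      then have "continuous_map (?Y x v) (?Y y v) id"
        by (auto simp: id_def)
      from continuous_map_compose[OF continuous_map_product_projection[OF that, of "?Y x"] this]
      show ?thesis
        by (simp add: o_def)
    qed
    then show "continuous_map (polyhedral_functor P X A x) (polyhedral_functor P X A y)
        (polyhedral_inclusion x y)"
      unfolding polyhedral_functor_def polyhedral_inclusion_def
      by (auto simp: continuous_map_componentwise PiE_def)
  qed (simp_all add: polyhedral_inclusion_def)
qed

theorem theorem5:
  fixes P :: "'p gorder" and X :: "'p \<Rightarrow> 'a topology" and A :: "'p \<Rightarrow> 'a set"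
  assumes "polyhedral P" and "reduced_poset P"
    and "\<And>v. v \<in> vertices P \<Longrightarrow> NDR_pair (X v) (A v)"
    and "\<And>v. v \<in> vertices P \<Longrightarrow> topspace (X v) \<noteq> A v"
  shows "homotopy_equivalence
           (polyhedral_product P X A)
           (polyhedral_product (simplicial_transform P) (st_family P X) (st_family P A))
           (st_natural_map P X A)"
proof -
  interpret partial_order P
    using assms(1) by (simp add: polyhedral_def)
  interpret polyhedral_poset P
    by unfold_locales (rule assms(1))
  let ?Q = "simplicial_transform P"
  let ?F = "polyhedral_functor P X A"
  let ?G = "polyhedral_functor ?Q (st_family P X) (st_family P A)"
  let ?\<psi> = "\<lambda>q. \<lambda>v\<in>vertices P. q (st_vertex P v)"
  have F: "top_diagram P ?F polyhedral_inclusion"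
    by (intro top_diagram_polyhedral_functor partial_order_axioms finite_carrier)
  have G: "top_diagram ?Q ?G polyhedral_inclusion"
    by (intro top_diagram_polyhedral_functor partial_order_simplicial_transform
        finite_simplicial_transform)
  have homeo: "homeomorphic_maps (?F x) (?G (st_map P x)) (st_reindex P) ?\<psi>" if x: "x \<in> carrier P" for x
  proof -
    let ?Y = "\<lambda>v. if v \<in> vertices_of P x then X v else subtopology (X v) (A v)"
    let ?Z = "\<lambda>w. if w \<in> vertices_of ?Q (st_map P x) then st_family P X w
      else subtopology (st_family P X w) (st_family P A w)"
    have F_eq: "?F x = product_topology ?Y (vertices P)"
      by (simp add: polyhedral_functor_def)
    have G_eq: "?G (st_map P x) = product_topology ?Z (st_vertex P ` vertices P)"
      by (simp add: polyhedral_functor_def vertices_simplicial_transform)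
    \<comment> \<open>Both products have the same factor at a vertex \<open>v\<close> and its copy \<open>[v, {v}]\<close>.\<close>
    have YZ: "?Z (st_vertex P v) = ?Y v" if "v \<in> vertices P" for v
      using st_vertex_mem_vertices_of_iff[OF that st_map_closed[OF x]] st_support_st_map[OF x] that
      by (simp add: st_family_def st_label_st_vertex)
    have "continuous_map (?F x) (?G (st_map P x)) (st_reindex P)"
      unfolding F_eq G_eq continuous_map_componentwise
      using continuous_map_product_projection[of _ "vertices P" ?Y]
      by (auto simp: st_reindex_def vertices_simplicial_transform st_label_st_vertex YZ
          simp del: if_split)
    moreover have "continuous_map (?G (st_map P x)) (?Y v) (\<lambda>q. q (st_vertex P v))"
      if "v \<in> vertices P" for v
      unfolding G_eq YZ[OF that, symmetric]
      using that by (intro continuous_map_product_projection imageI)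
    then have "continuous_map (?G (st_map P x)) (?F x) ?\<psi>"
      unfolding F_eq continuous_map_componentwise by (auto simp del: if_split)
    moreover have "?\<psi> (st_reindex P p) = p" if "p \<in> topspace (?F x)" for p
      using that unfolding F_eq topspace_product_topology
      by (auto simp: st_reindex_def vertices_simplicial_transform st_label_st_vertex PiE_def
          extensional_def restrict_def fun_eq_iff)
    moreover have "st_reindex P (?\<psi> q) = q" if "q \<in> topspace (?G (st_map P x))" for q
      using that unfolding G_eq topspace_product_topology
      by (auto simp: st_reindex_def vertices_simplicial_transform st_label_st_vertex PiE_def
          extensional_def restrict_def fun_eq_iff)
    ultimately show ?thesis
      by (simp add: homeomorphic_maps_def)
  qed
  have base: "st_base (st_map P x) = x" if "x \<in> carrier P" for x
    using assms(2) that by (rule st_base_st_map)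
  have "diagram_map P ?F polyhedral_inclusion ?Q ?G polyhedral_inclusion (st_map P) (\<lambda>_. st_reindex P)"
  proof (intro diagram_map.intro diagram_map_axioms.intro F G)
    show "st_map P \<in> carrier P \<rightarrow> carrier ?Q"
      using st_map_closed by blast
    show "st_map P x \<sqsubseteq>\<^bsub>?Q\<^esub> st_map P y" if "x \<in> carrier P" "y \<in> carrier P" "x \<sqsubseteq>\<^bsub>P\<^esub> y" for x y
      using that vertices_of_mono
      by (simp add: simplicial_transform_le_iff st_map_closed base st_support_st_map)
    show "continuous_map (?F x) (?G (st_map P x)) (st_reindex P)" if "x \<in> carrier P" for x
      using homeo[OF that] by (simp add: homeomorphic_maps_def)
  qed (simp add: polyhedral_inclusion_def)
  then show ?thesis
    unfolding polyhedral_product_def st_natural_map_def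
  proof (rule homotopy_equivalence_hocolim_map[where l = st_base and \<psi> = "\<lambda>_. ?\<psi>"])
    show "st_base \<in> carrier ?Q \<rightarrow> carrier P"
      using simplicial_transform_normal_form(1) by blast
    show "st_base c \<sqsubseteq>\<^bsub>P\<^esub> st_base d"
      if "c \<in> carrier ?Q" "d \<in> carrier ?Q" "c \<sqsubseteq>\<^bsub>?Q\<^esub> d" for c d
      using that by (simp add: simplicial_transform_le_iff)
    show "c \<sqsubseteq>\<^bsub>?Q\<^esub> st_map P (st_base c)" if c: "c \<in> carrier ?Q" for c
      using simplicial_transform_normal_form[OF c] c
      by (simp add: simplicial_transform_le_iff st_map_closed base st_support_st_map)
  qed (simp_all add: base homeo)
qed

end
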